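(* Let $u\in\mathbb{S}^2$ and let $A=A^\top\in\mathbb{R}^{3\times3}$ be such that $W=\mathrm{tr}(A)I-A$ is symmetric positive definite. Let $\mathcal{Q}:=\{1,2\}$ and $k_1=-k_2=k\neq 0$, where $$|k|<\frac{1}{2\lambda_{\max}^W\sqrt{6-\max\{1,4\xi^2\}}},\qquad \xi=\lambda_{\min}^W/\lambda_{\max}^W .$$ Consider $\Gamma(R,q)=R\,\mathcal{R}_a(\theta_q(R),u)$ with $\theta_q(R)=2\arcsin(k_qV_A(R))$, for $(R,q)\in SO(3)\times\mathcal{Q}$. Assume that $\Delta(v,u)>0$ for all $v\in\mathcal{E}(A)$. Then $\mathcal{U}(R,q)=V_A(\Gamma(R,q))$ is (centrally) synergistic with synergistic gap $\bar\delta$ given by $$\bar\delta=\min_{v\in\mathcal{E}(A)}\sigma(k,\lambda^W,\Delta(v,u))\;\geq\;\sigma(k,\underline\lambda,\underline\Delta),$$ where $$\sigma(k,\lambda^W,\Delta(v,u))=8k^2\bar V^2(1-k^2\bar V^2)\Delta(v,u),\qquad \bar V=\frac{-1+\sqrt{1+16\lambda^Wk^2\Delta(v,u)}}{4k^2\Delta(v,u)},$$ $\lambda^W$ denotes the eigenvalue of $W$ associated with $v$, $\underline\lambda=\min_{v\in\mathcal{E}(A)}\lambda^W$ and $\underline\Delta=\min_{v\in\mathcal{E}(A)}\Delta(v,u)$.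
   Context: Notation. $I$ is the $3\times3$ identity; $[u]_\times$ is the skew-symmetric matrix with $[u]_\times x=u\times x$; $\mathcal{R}_a(\theta,u)=e^{\theta[u]_\times}$ for $\theta\in\mathbb{R}$, $u\in\mathbb{S}^2$. $V_A(R)=\mathrm{tr}(A(I-R))$. $\lambda_{\min}^W,\lambda_{\max}^W$ are the smallest and largest eigenvalues of $W$. $SO(3)$ carries the Riemannian metric $\langle R\Omega_1,R\Omega_2\rangle_R=\mathrm{tr}(\Omega_1^\top\Omega_2)$ ($\Omega_1,\Omega_2$ skew-symmetric), and $\nabla$ is the corresponding gradient with respect to $R$. Synergism. Let $\mathcal{A}=\{I\}\times\mathcal{Q}$. $\mathcal{P}(\mathcal{A})$ is the set of functions $\mathcal{U}:SO(3)\times\mathcal{Q}\to[0,\infty)$, continuously differentiable in $R$ for each $q$, with $\mathcal{U}=0$ on $\mathcal{A}$ and $\mathcal{U}>0$ off $\mathcal{A}$. $\Psi_{\mathcal{U}}$ is the set of $(R,q)$ with $\nabla\mathcal{U}(R,q)=0$. A function $\mathcal{U}\in\mathcal{P}(\mathcal{A})$ is centrally synergistic if and only if there is a constant $\delta>0$ with $$\bar\delta:=\min_{(R,q)\in\Psi_{\mathcal{U}}\setminus\mathcal{A}}\Big[\mathcal{U}(R,q)-\min_{p\in\mathcal{Q}}\mathcal{U}(R,p)\Big]>\delta ,$$ and $\bar\delta$ is called the synergistic gap of $\mathcal{U}$. The quantity $\Delta(v,u)$. $\mathcal{E}(A)$ is the set of real unit eigenvectors of $A$; $\{v_1,v_2,v_3\}$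 is an orthonormal eigenbasis of $A$, with $v_i$ associated to $\lambda_i^A$; $\lambda_i^W=\mathrm{tr}(A)-\lambda_i^A$ is the eigenvalue of $W$ for $v_i$. Then $\Delta(v,u)$, with $\Delta(-v,u)=\Delta(v,u)$, is given as follows. (1) If $A=\lambda I$ (so $\mathcal{E}(A)=\mathbb{S}^2$): $\Delta(v,u)=\lambda^W\cos^2\phi$, $\phi=\angle(u,v)$. (2) If $\lambda_1^A=\lambda_2^A\neq\lambda_3^A$ (so $\mathcal{E}(A)$ consists of $\pm v_3$ and all unit vectors $v_{12}\in\mathrm{span}\{v_1,v_2\}$): $\Delta(v_{12},u)=(1-(u^\top v_3)^2)\,[\lambda_2^W-\lambda_3^W\sin^2\phi]$ with $\phi=\angle(v_{12},u^\perp)$, $u^\perp$ the orthogonal projection of $u$ on $\mathrm{span}\{v_1,v_2\}$ (the value is $0$ if $u^\perp=0$); $\Delta(v_3,u)=\lambda_3^W-\lambda_2^W(1-(u^\top v_3)^2)$. (3) If $\lambda_1^A<\lambda_2^A<\lambda_3^A$ (so $\mathcal{E}(A)=\{\pm v_1,\pm v_2,\pm v_3\}$): $\Delta(v_1,u)=\lambda_1^W-(u^\top v_2)^2\lambda_3^W-(u^\top v_3)^2\lambda_2^W$, $\Delta(v_2,u)=\lambda_2^W-(u^\top v_3)^2\lambda_1^W-(u^\top v_1)^2\lambda_3^W$, $\Delta(v_3,u)=\lambda_3^W-(u^\top v_1)^2\lambda_2^W-(u^\top v_2)^2\lambda_1^W$. *)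

theory Defs
  imports "HOL-Analysis.Analysis"
begin

unbundle no cross3_syntax

definition is_minimum :: "real \<Rightarrow> real set \<Rightarrow> bool" where
  "is_minimum m S \<longleftrightarrow> m \<in> S \<and> (\<forall>x\<in>S. m \<le> x)"

definition eigenvalues :: "real^3^3 \<Rightarrow> real set" where
  "eigenvalues M = {l. \<exists>v. v \<noteq> 0 \<and> M *v v = l *\<^sub>R v}"

definition lam_min :: "real^3^3 \<Rightarrow> real" where
  "lam_min M = Min (eigenvalues M)"

definition lam_max :: "real^3^3 \<Rightarrow> real" where
  "lam_max M = Max (eigenvalues M)"

definition unit_eigenvectors :: "real^3^3 \<Rightarrow> (real^3) set" where
  "unit_eigenvectors M = {v. norm v = 1 \<and> (\<exists>l. M *v v = l *\<^sub>R v)}"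

definition eigenvalue_of :: "real^3^3 \<Rightarrow> real^3 \<Rightarrow> real" where
  "eigenvalue_of M v = (THE l. M *v v = l *\<^sub>R v)"

definition sym_pos_def :: "real^3^3 \<Rightarrow> bool" where
  "sym_pos_def M \<longleftrightarrow> transpose M = M \<and> (\<forall>x. x \<noteq> 0 \<longrightarrow> 0 < x \<bullet> (M *v x))"

text \<open>The type \<^typ>\<open>real^3^3\<close> carries the componentwise product, so the library constants
  \<^const>\<open>power\<close> and \<^const>\<open>exp\<close> do not denote the matrix power and the matrix exponential.\<close>

definition matrix_exp :: "real^3^3 \<Rightarrow> real^3^3" where
  "matrix_exp M = (\<Sum>n. (1 / fact n) *\<^sub>R (((\<lambda>X. M ** X) ^^ n) (mat 1)))"

definition skew :: "real^3 \<Rightarrow> real^3^3" where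
  "skew u = matrix (\<lambda>x. cross3 u x)"

definition rot_axis :: "real \<Rightarrow> real^3 \<Rightarrow> real^3^3" where
  "rot_axis \<theta> u = matrix_exp (\<theta> *\<^sub>R skew u)"

definition SO3 :: "(real^3^3) set" where
  "SO3 = {R. rotation_matrix R}"

definition tangent_SO3 :: "real^3^3 \<Rightarrow> (real^3^3) set" where
  "tangent_SO3 R = {R ** \<Omega> | \<Omega>. transpose \<Omega> = - \<Omega>}"

definition metric_SO3 :: "real^3^3 \<Rightarrow> real^3^3 \<Rightarrow> real^3^3 \<Rightarrow> real" where
  "metric_SO3 R X Y = trace (transpose (transpose R ** X) ** (transpose R ** Y))"

text \<open>Differentiability on the embedded submanifold \<^term>\<open>SO3\<close> is Frechet differentiability relative
  to the subset \<^term>\<open>SO3\<close>. The ambient linear map \<open>D\<close> is then determined exactly on the tangent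
  space, where it is the differential of \<open>f\<close>.\<close>

definition has_gradient_SO3 :: "(real^3^3 \<Rightarrow> real) \<Rightarrow> real^3^3 \<Rightarrow> real^3^3 \<Rightarrow> bool" where
  "has_gradient_SO3 f G R \<longleftrightarrow> G \<in> tangent_SO3 R \<and>
     (\<exists>D. (f has_derivative D) (at R within SO3) \<and>
          (\<forall>X \<in> tangent_SO3 R. D X = metric_SO3 R G X))"

definition C1_SO3 :: "(real^3^3 \<Rightarrow> real) \<Rightarrow> bool" where
  "C1_SO3 f \<longleftrightarrow> (\<exists>G. continuous_on SO3 G \<and> (\<forall>R\<in>SO3. has_gradient_SO3 f (G R) R))"

definition attractor :: "'q set \<Rightarrow> ((real^3^3) \<times> 'q) set" where
  "attractor Q = {mat 1} \<times> Q"

definition potential_functions :: "'q set \<Rightarrow> ((real^3^3) \<times> 'q \<Rightarrow> real) set" where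
  "potential_functions Q = {U.
     (\<forall>x \<in> SO3 \<times> Q. 0 \<le> U x) \<and>
     (\<forall>q\<in>Q. C1_SO3 (\<lambda>R. U (R, q))) \<and>
     (\<forall>x \<in> attractor Q. U x = 0) \<and>
     (\<forall>x \<in> SO3 \<times> Q - attractor Q. 0 < U x)}"

definition critical_set :: "'q set \<Rightarrow> ((real^3^3) \<times> 'q \<Rightarrow> real) \<Rightarrow> ((real^3^3) \<times> 'q) set" where
  "critical_set Q U = {(R, q). R \<in> SO3 \<and> q \<in> Q \<and> has_gradient_SO3 (\<lambda>R. U (R, q)) 0 R}"

definition has_synergistic_gap ::
    "'q set \<Rightarrow> ((real^3^3) \<times> 'q \<Rightarrow> real) \<Rightarrow> real \<Rightarrow> bool" where
  "has_synergistic_gap Q U gap \<longleftrightarrow>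
     is_minimum gap ((\<lambda>(R, q). U (R, q) - Min ((\<lambda>p. U (R, p)) ` Q)) `
                       (critical_set Q U - attractor Q))"

definition centrally_synergistic :: "'q set \<Rightarrow> ((real^3^3) \<times> 'q \<Rightarrow> real) \<Rightarrow> bool" where
  "centrally_synergistic Q U \<longleftrightarrow> U \<in> potential_functions Q \<and>
     (\<exists>gap \<delta>. has_synergistic_gap Q U gap \<and> 0 < \<delta> \<and> \<delta> < gap)"

definition V_pot :: "real^3^3 \<Rightarrow> real^3^3 \<Rightarrow> real" where
  "V_pot A R = trace (A ** (mat 1 - R))"

definition W_mat :: "real^3^3 \<Rightarrow> real^3^3" where
  "W_mat A = trace A *\<^sub>R mat 1 - A"

definition warp_angle :: "real^3^3 \<Rightarrow> real \<Rightarrow> real^3^3 \<Rightarrow> real" where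
  "warp_angle A kq R = 2 * arcsin (kq * V_pot A R)"

definition Gamma_warp ::
    "real^3^3 \<Rightarrow> real^3 \<Rightarrow> ('q \<Rightarrow> real) \<Rightarrow> (real^3^3) \<times> 'q \<Rightarrow> real^3^3" where
  "Gamma_warp A u \<kappa> = (\<lambda>(R, q). R ** rot_axis (warp_angle A (\<kappa> q) R) u)"

definition vec_angle :: "real^3 \<Rightarrow> real^3 \<Rightarrow> real" where
  "vec_angle x y = arccos ((x \<bullet> y) / (norm x * norm y))"

text \<open>An orthonormal eigenbasis \<open>b\<close> with eigenvalues \<open>l\<close>, numbered such that exactly one of the
  three cases in the definition of \<open>\<Delta>\<close> applies. The numerals are the indices of \<^typ>\<open>real^3\<close>.\<close>

definition eigenframe :: "real^3^3 \<Rightarrow> (3 \<Rightarrow> real) \<Rightarrow> (3 \<Rightarrow> real^3) \<Rightarrow> bool" where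
  "eigenframe A l b \<longleftrightarrow>
     (\<forall>i. A *v b i = l i *\<^sub>R b i) \<and>
     (\<forall>i j. b i \<bullet> b j = (if i = j then 1 else 0)) \<and>
     (l 1 = l 2 \<and> l 2 = l 3 \<or> l 1 = l 2 \<and> l 2 \<noteq> l 3 \<or> l 1 < l 2 \<and> l 2 < l 3)"

text \<open>In the second case, \<open>(u \<bullet> b 1) *\<^sub>R b 1 + (u \<bullet> b 2) *\<^sub>R b 2\<close> is the orthogonal projection of
  the unit vector \<open>u\<close>; if it vanishes, then \<open>1 - (u \<bullet> b 3)\<^sup>2 = 0\<close>, so the value is \<open>0\<close>. The function
  is meant for unit eigenvectors \<open>v\<close> only; in the third case these are \<open>\<plusminus> b i\<close>.\<close>

definition Delta ::
    "real^3^3 \<Rightarrow> (3 \<Rightarrow> real) \<Rightarrow> (3 \<Rightarrow> real^3) \<Rightarrow> real^3 \<Rightarrow> real^3 \<Rightarrow> real" where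
  "Delta A l b v u = (let w = (\<lambda>i. trace A - l i) in
     if l 1 = l 2 \<and> l 2 = l 3 then w 1 * (cos (vec_angle u v))\<^sup>2
     else if l 1 = l 2 then
       (if v = b 3 \<or> v = - b 3 then w 3 - w 2 * (1 - (u \<bullet> b 3)\<^sup>2)
        else (1 - (u \<bullet> b 3)\<^sup>2) *
             (w 2 - w 3 * (sin (vec_angle v ((u \<bullet> b 1) *\<^sub>R b 1 + (u \<bullet> b 2) *\<^sub>R b 2)))\<^sup>2))
     else
       (if v = b 1 \<or> v = - b 1 then w 1 - (u \<bullet> b 2)\<^sup>2 * w 3 - (u \<bullet> b 3)\<^sup>2 * w 2
        else if v = b 2 \<or> v = - b 2 then w 2 - (u \<bullet> b 3)\<^sup>2 * w 1 - (u \<bullet> b 1)\<^sup>2 * w 3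
        else w 3 - (u \<bullet> b 1)\<^sup>2 * w 2 - (u \<bullet> b 2)\<^sup>2 * w 1))"

definition V_bar :: "real \<Rightarrow> real \<Rightarrow> real \<Rightarrow> real" where
  "V_bar k lam D = (- 1 + sqrt (1 + 16 * lam * k\<^sup>2 * D)) / (4 * k\<^sup>2 * D)"

definition gap_sigma :: "real \<Rightarrow> real \<Rightarrow> real \<Rightarrow> real" where
  "gap_sigma k lam D = 8 * k\<^sup>2 * (V_bar k lam D)\<^sup>2 * (1 - k\<^sup>2 * (V_bar k lam D)\<^sup>2) * D"

end

theory Submission
  imports Defs
begin

text \<open>For \<open>R\<close> given by a unit quaternion \<open>(a, e)\<close> one has \<open>V\<^sub>A(R) = 2 e\<^sup>T W e\<close>, whose critical points
  are \<open>I\<close> and the half turns \<open>(0, v)\<close> about unit eigenvectors \<open>v\<close> of \<open>A\<close>. The bound on \<open>k\<close> makes the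
  differential of \<open>\<Gamma>\<close> invertible, so \<open>R\<close> is critical for \<open>U\<close> iff \<open>\<Gamma>(R,q)\<close> is critical for \<open>V\<^sub>A\<close>.
  In all three cases \<open>\<Delta>(v,u) = v\<^sup>T W v - (u \<times> v)\<^sup>T W (u \<times> v)\<close>, and composing the half turn about \<open>v\<close>
  with a rotation by \<open>t\<close> about \<open>u\<close> gives \<open>V\<^sub>A = 2 (\<lambda> - sin\<^sup>2(t/2) \<Delta>)\<close>. With \<open>sin(\<theta>/2) = k V\<^sub>A(R)\<close>
  the potential \<open>V\<^sub>A(R)\<close> at such a critical point therefore solves \<open>2 k\<^sup>2 \<Delta> V\<^sup>2 + V = 2 \<lambda>\<close>, that is
  \<open>V = V_bar k \<lambda> \<Delta>\<close>, and switching \<open>q\<close> doubles the angle to \<open>2\<theta>\<close>, which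
  lowers the potential by \<open>2 sin\<^sup>2(\<theta>) \<Delta> = \<sigma>\<close>. The lower bound holds because \<open>\<sigma>\<close> is increasing in \<open>\<lambda>\<close>
  and in \<open>\<Delta>\<close> as long as \<open>k\<^sup>2 V\<^sup>2 \<le> 1/2\<close>.\<close>

section \<open>Unit quaternions and rotations\<close>

text \<open>Through the interpretation below this yields the distributivity, scaling, derivative and
  continuity rules for \<open>**\<close> all at once.\<close>

lemma bounded_bilinear_matrix_mul: "bounded_bilinear ((**) :: real^'n^'m \<Rightarrow> real^'p^'n \<Rightarrow> real^'p^'m)"
  unfolding bilinear_conv_bounded_bilinear[symmetric] bilinear_def
  by (auto intro!: linearI simp: vec_eq_iff matrix_matrix_mult_def sum.distrib sum_distrib_left algebra_simps)

interpretation matrix_mul: bounded_bilinear "(**) :: real^'n^'m \<Rightarrow> real^'p^'n \<Rightarrow> real^'p^'m"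
  by (rule bounded_bilinear_matrix_mul)

lemma skew_vector: "skew u = vector [vector [0, - u$3, u$2], vector [u$3, 0, - u$1], vector [- u$2, u$1, 0]]"
  by (simp add: skew_def matrix_def vec_eq_iff forall_3 cross3_def axis_def)

lemma skew_nth [simp]:
  "skew u $ 1 $ 1 = 0" "skew u $ 1 $ 2 = - u$3" "skew u $ 1 $ 3 = u$2"
  "skew u $ 2 $ 1 = u$3" "skew u $ 2 $ 2 = 0" "skew u $ 2 $ 3 = - u$1"
  "skew u $ 3 $ 1 = - u$2" "skew u $ 3 $ 2 = u$1" "skew u $ 3 $ 3 = 0"
  by (simp_all add: skew_vector)

lemma skew_mult_vec: "skew u *v x = cross3 u x"
  by (simp add: vec_eq_iff forall_3 matrix_vector_mult_def sum_3 cross3_def)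

lemma skew_add: "skew (x + y) = skew x + skew y"
  by (simp add: vec_eq_iff forall_3)

lemma skew_scaleR: "skew (c *\<^sub>R x) = c *\<^sub>R skew x"
  by (simp add: vec_eq_iff forall_3)

lemma transpose_skew: "transpose (skew u) = - skew u"
  by (simp add: vec_eq_iff forall_3 transpose_def)

lemma antisym_eq_skew:
  fixes Om :: "real^3^3"
  assumes "transpose Om = - Om"
  obtains w where "Om = skew w"
proof -
  have *: "Om$i$j = - (Om$j$i)" for i j
    using arg_cong[OF assms, of "\<lambda>M. M$j$i"] by (simp add: transpose_def)
  have "Om = skew (vector [Om$3$2, Om$1$3, Om$2$1])"
    using *[of 1 1] *[of 2 2] *[of 3 3] *[of 1 2] *[of 1 3] *[of 2 3]
    by (simp add: vec_eq_iff forall_3)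
  then show thesis by (rule that)
qed

lemma skew_square: "skew u ** skew u = (\<chi> i j. u$i * u$j) - (u \<bullet> u) *\<^sub>R mat 1"
  by (simp add: vec_eq_iff forall_3 matrix_matrix_mult_def mat_def inner_vec_def sum_3)

lemma trace_skew_skew: "trace (transpose (skew g) ** skew w) = 2 * (g \<bullet> w)"
  by (simp add: trace_def matrix_matrix_mult_def transpose_def sum_3 inner_vec_def)

text \<open>Not normalised, so that \<open>quat_rot_mult\<close> is a polynomial identity without side conditions.\<close>

definition quat_rot :: "real \<Rightarrow> real^3 \<Rightarrow> real^3^3" where
  "quat_rot a e = (a\<^sup>2 - e \<bullet> e) *\<^sub>R mat 1 + 2 *\<^sub>R (\<chi> i j. e$i * e$j) + (2 * a) *\<^sub>R skew e"

text \<open>The arguments on the right are the Hamilton product of the quaternions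
  \<open>(a, e)\<close> and \<open>(c, f)\<close>.\<close>

lemma quat_rot_mult:
  "quat_rot a e ** quat_rot c f = quat_rot (a * c - e \<bullet> f) (a *\<^sub>R f + c *\<^sub>R e + cross3 e f)"
  by (simp add: quat_rot_def vec_eq_iff forall_3 matrix_matrix_mult_def sum_3 mat_def inner_vec_def cross3_def,
      intro conjI) algebra+

lemma quat_rot_one [simp]: "quat_rot 1 0 = mat 1"
  by (simp add: quat_rot_def vec_eq_iff forall_3 mat_def)

lemma quat_rot_mult_vec:
  "quat_rot a e *v x = (a\<^sup>2 - e \<bullet> e) *\<^sub>R x + (2 * (e \<bullet> x)) *\<^sub>R e + (2 * a) *\<^sub>R cross3 e x"
  by (simp add: quat_rot_def vec_eq_iff forall_3 matrix_vector_mult_def sum_3 mat_def inner_vec_def cross3_def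
      algebra_simps)

lemma transpose_quat_rot: "transpose (quat_rot a e) = quat_rot a (- e)"
  by (simp add: quat_rot_def vec_eq_iff forall_3 transpose_def mat_def inner_vec_def)

lemma det_quat_rot: "det (quat_rot a e) = (a\<^sup>2 + e \<bullet> e) ^ 3"
  by (simp add: quat_rot_def det_3 mat_def inner_vec_def sum_3) algebra

lemma quat_rot_SO3:
  assumes "a\<^sup>2 + e \<bullet> e = 1"
  shows "quat_rot a e \<in> SO3"
proof -
  have "transpose (quat_rot a e) ** quat_rot a e = mat 1"
    using assms by (simp add: transpose_quat_rot quat_rot_mult power2_eq_square)
  then show ?thesis
    using assms by (simp add: SO3_def rotation_matrix_def orthogonal_matrix det_quat_rot)
qed

text \<open>Eliminating \<open>a^2\<close> leaves
  \<open>2 (e \<bullet> e) tr A - 2 e \<bullet> A e\<close>; the term with \<open>skew e\<close> has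
  trace zero against the symmetric \<open>A\<close>.\<close>

lemma V_pot_quat_rot:
  fixes A :: "real^3^3"
  assumes "transpose A = A" "a\<^sup>2 + e \<bullet> e = 1"
  shows "V_pot A (quat_rot a e) = 2 * (e \<bullet> (W_mat A *v e))"
proof -
  have *: "A$2$1 = A$1$2" "A$3$1 = A$1$3" "A$3$2 = A$2$3"
    using assms(1) by (auto simp: vec_eq_iff transpose_def)
  have a: "a\<^sup>2 = 1 - e \<bullet> e" using assms(2) by simp
  show ?thesis
    unfolding V_pot_def quat_rot_def a
    by (simp add: W_mat_def trace_def matrix_matrix_mult_def matrix_vector_mult_def
        mat_def inner_vec_def sum_3 *) algebra
qed

text \<open>Up to sign this is the derivative of \<open>V_pot A\<close> along the tangent vector
  \<open>quat_rot a e ** skew z\<close>, under which \<open>e\<close> moves with velocity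
  \<open>(a z + e \<times> z) / 2\<close>.\<close>

lemma trace_quat_rot_skew:
  fixes A :: "real^3^3"
  assumes "transpose A = A"
  shows "trace (A ** (quat_rot a e ** skew z)) = - 2 * ((W_mat A *v e) \<bullet> (a *\<^sub>R z + cross3 e z))"
proof -
  have *: "A$2$1 = A$1$2" "A$3$1 = A$1$3" "A$3$2 = A$2$3"
    using assms(1) by (auto simp: vec_eq_iff transpose_def)
  show ?thesis
    unfolding quat_rot_def
    by (simp add: W_mat_def trace_def matrix_matrix_mult_def matrix_vector_mult_def
        mat_def inner_vec_def sum_3 cross3_def *) algebra
qed

lemma orthonormal_expansion:
  fixes b :: "3 \<Rightarrow> real^3"
  assumes "\<And>i j. b i \<bullet> b j = (if i = j then 1 else 0)"
  shows "x = (x \<bullet> b 1) *\<^sub>R b 1 + (x \<bullet> b 2) *\<^sub>R b 2 + (x \<bullet> b 3) *\<^sub>R b 3"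
proof -
  define B :: "real^3^3" where "B = (\<chi> i. b i)"
  have "B ** transpose B = mat 1"
    using assms by (simp add: vec_eq_iff B_def matrix_matrix_mult_def transpose_def mat_def inner_vec_def)
  then have "transpose B ** B = mat 1"
    using matrix_left_right_inverse by blast
  then have "transpose B *v (B *v x) = x"
    by (simp add: matrix_vector_mul_assoc)
  then show ?thesis
    by (simp add: vec_eq_iff B_def matrix_vector_mult_def transpose_def inner_vec_def sum_3 algebra_simps)
qed

lemma orthonormal_inner:
  fixes b :: "3 \<Rightarrow> real^3"
  assumes "\<And>i j. b i \<bullet> b j = (if i = j then 1 else 0)"
  shows "x \<bullet> y = (x \<bullet> b 1) * (y \<bullet> b 1) + (x \<bullet> b 2) * (y \<bullet> b 2) + (x \<bullet> b 3) * (y \<bullet> b 3)"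
proof -
  have "x \<bullet> y = ((x \<bullet> b 1) *\<^sub>R b 1 + (x \<bullet> b 2) *\<^sub>R b 2 + (x \<bullet> b 3) *\<^sub>R b 3) \<bullet> y"
    using orthonormal_expansion[OF assms, of x] by simp
  then show ?thesis
    by (simp add: inner_add_left inner_commute[of "b _" y])
qed

section \<open>Every rotation comes from a unit quaternion\<close>

lemma SO3_mult: "R \<in> SO3 \<Longrightarrow> S \<in> SO3 \<Longrightarrow> R ** S \<in> SO3"
  by (simp add: SO3_def rotation_matrix_def orthogonal_matrix_mul det_mul)

lemma SO3_transpose_mult: "R \<in> SO3 \<Longrightarrow> transpose R ** R = mat 1"
  by (simp add: SO3_def rotation_matrix_def orthogonal_matrix)

text \<open>Euler's rotation theorem: \<open>R - I = R (I - R^T)\<close> gives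
  \<open>det (R - I) = det (I - R)\<close>, which equals \<open>- det (R - I)\<close> in odd
  dimension, so 1 is an eigenvalue.\<close>

lemma SO3_fixed_vector:
  assumes "R \<in> SO3"
  obtains v where "norm v = 1" "R *v v = v"
proof -
  have R: "R ** transpose R = mat 1" "det R = 1"
    using assms by (auto simp: SO3_def rotation_matrix_def orthogonal_matrix_def)
  have "R ** (mat 1 - transpose R) = R - mat 1"
    using R by (simp add: matrix_mul.diff_right)
  then have "det (R - mat 1) = det (mat 1 - transpose R)"
    using R(2) by (metis det_mul mult_1)
  also have "\<dots> = det (transpose (mat 1 - R))"
    by (rule arg_cong[where f = det]) (simp add: vec_eq_iff transpose_def mat_def)
  also have "\<dots> = det (- 1 *\<^sub>R (R - mat 1))"
    by (simp add: det_transpose)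
  also have "\<dots> = - det (R - mat 1)"
    by (simp add: det_3 algebra_simps)
  finally have "det (R - mat 1) = 0" by simp
  then have "\<not> invertible (R - mat 1)" by (simp add: invertible_det_nz)
  then obtain x where x: "x \<noteq> 0" "(R - mat 1) *v x = 0"
    unfolding invertible_left_inverse matrix_left_invertible_ker by blast
  have "R *v x = x" using x(2) by (simp add: matrix_vector_mult_diff_rdistrib)
  then have "R *v (x /\<^sub>R norm x) = x /\<^sub>R norm x"
    by (simp add: matrix_vector_mult_scaleR)
  then show thesis using x(1) that[of "x /\<^sub>R norm x"] by simp
qed

text \<open>In an orthonormal frame of the axis \<open>v\<close> and two vectors \<open>e\<close>,
  \<open>f\<close> orthogonal to it, \<open>R\<close> is a plane rotation by some angle
  \<open>t\<close>, and the quaternion with half that angle acts on the frame in the same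
  way.\<close>

lemma SO3_obtain_quat_rot:
  assumes "R \<in> SO3"
  obtains a e where "a\<^sup>2 + e \<bullet> e = 1" "R = quat_rot a e"
proof -
  obtain v where v: "norm v = 1" "R *v v = v" by (rule SO3_fixed_vector[OF assms])
  obtain y where y: "y \<noteq> 0" "orthogonal v y"
    by (rule orthogonal_to_vector_exists[of v]) auto
  define e where "e = y /\<^sub>R norm y"
  define f where "f = cross3 v e"
  have vv: "v \<bullet> v = 1" using v by (simp add: norm_eq_1)
  have ee: "e \<bullet> e = 1" using y by (simp add: e_def dot_square_norm power2_eq_square)
  have ve: "v \<bullet> e = 0" using y by (simp add: e_def orthogonal_def)
  have vf: "v \<bullet> f = 0" "e \<bullet> f = 0" by (simp_all add: f_def dot_cross_self)
  have ff: "f \<bullet> f = 1"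
    using norm_cross_dot[of v e] v ee ve by (simp add: f_def norm_eq_1 dot_square_norm)
  define B where "B = (\<lambda>i::3. if i = 1 then v else if i = 2 then e else f)"
  have B: "B i \<bullet> B j = (if i = j then 1 else 0)" for i j
    using vv ee ff ve vf exhaust_3[of i] exhaust_3[of j] by (auto simp: B_def inner_commute)
  have expand: "x = (x \<bullet> v) *\<^sub>R v + (x \<bullet> e) *\<^sub>R e + (x \<bullet> f) *\<^sub>R f" for x
    using orthonormal_expansion[of B x] B by (simp add: B_def)
  have vf': "cross3 v f = - e"
    using vv ve by (simp add: f_def vec_eq_iff forall_3 cross3_def inner_vec_def sum_3) algebra
  have rot: "rotation_matrix R" using assms by (simp add: SO3_def)
  have iso: "(R *v x) \<bullet> (R *v z) = x \<bullet> z" for x z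
    using SO3_transpose_mult[OF assms]
    by (metis dot_lmul_matrix matrix_vector_mul_assoc matrix_vector_mul_lid transpose_matrix_vector)
  define c s where "c = (R *v e) \<bullet> e" and "s = (R *v e) \<bullet> f"
  have Rev: "(R *v e) \<bullet> v = 0" using iso[of e v] v ve by (simp add: inner_commute)
  have Re: "R *v e = c *\<^sub>R e + s *\<^sub>R f"
    using expand[of "R *v e"] Rev by (simp add: c_def s_def)
  \<comment> \<open>Rotations preserve the cross product, so the images of \<open>v\<close> and
    \<open>e\<close> determine that of \<open>f\<close>.\<close>
  have "R *v f = cross3 (R *v v) (R *v e)"
    using cross_rotation_matrix[OF rot] by (simp add: f_def)
  then have Rf: "R *v f = c *\<^sub>R f - s *\<^sub>R e"
    using vf' by (simp add: v Re cross_add_right cross_mult_right flip: f_def)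
  have "c\<^sup>2 + s\<^sup>2 = 1"
    using iso[of e e] ee ff vf(2) unfolding Re
    by (simp add: inner_add_left inner_add_right inner_commute power2_eq_square)
  then obtain t where t: "c = cos t" "s = sin t" using sincos_total_2pi by metis
  define \<eta> \<sigma> where "\<eta> = cos (t / 2)" and "\<sigma> = sin (t / 2)"
  have unit: "\<eta>\<^sup>2 + \<sigma>\<^sup>2 = 1" by (simp add: \<eta>_def \<sigma>_def)
  have cs: "c = \<eta>\<^sup>2 - \<sigma>\<^sup>2" "s = 2 * \<sigma> * \<eta>"
    using cos_double[of "t/2"] sin_double[of "t/2"] by (simp_all add: t \<eta>_def \<sigma>_def)
  let ?P = "quat_rot \<eta> (\<sigma> *\<^sub>R v)"
  have P: "?P *v x = (\<eta>\<^sup>2 - \<sigma>\<^sup>2) *\<^sub>R x + (2 * \<sigma>\<^sup>2 * (v \<bullet> x)) *\<^sub>R v + (2 * \<eta> * \<sigma>) *\<^sub>R cross3 v x" for x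
    by (simp add: quat_rot_mult_vec vv cross_mult_left power2_eq_square)
  have lin: "M *v x = (x \<bullet> v) *\<^sub>R (M *v v) + (x \<bullet> e) *\<^sub>R (M *v e) + (x \<bullet> f) *\<^sub>R (M *v f)"
    for M :: "real^3^3" and x
    using arg_cong[OF expand[of x], of "(*v) M"]
    by (simp add: matrix_vector_mult_scaleR matrix_vector_right_distrib)
  have "?P *v v = v" using unit by (simp add: P vv add.commute flip: scaleR_left_distrib)
  moreover have "?P *v e = R *v e" by (simp add: P ve Re cs f_def)
  moreover have "?P *v f = R *v f" by (simp add: P vf Rf cs vf' mult_ac)
  ultimately have "?P *v x = R *v x" for x
    using lin[of ?P x] lin[of R x] v(2) by presburger
  then have "R = ?P" by (simp add: matrix_eq)
  moreover have "\<eta>\<^sup>2 + (\<sigma> *\<^sub>R v) \<bullet> (\<sigma> *\<^sub>R v) = 1"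
    using unit by (simp add: vv power2_eq_square)
  ultimately show thesis by (rule that[rotated])
qed

section \<open>The matrix exponential of a skew matrix: Rodrigues' formula and its quaternion
  form\<close>

lemma skew_cube:
  assumes "norm u = 1"
  shows "skew u ** (skew u ** skew u) = - skew u"
proof -
  have "u$1 * u$1 + u$2 * u$2 + u$3 * u$3 = 1"
    using assms by (simp add: norm_eq_1 inner_vec_def sum_3)
  then show ?thesis
    by (simp add: vec_eq_iff forall_3 matrix_matrix_mult_def sum_3) algebra
qed

text \<open>Since the cube of \<open>skew u\<close> is \<open>- skew u\<close>, odd powers are
  multiples of \<open>skew u\<close> and even positive powers multiples of its square, with the
  signs of the sine and cosine series. The last summand corrects the term at \<open>n = 0\<close>,
  where the pattern would give \<open>- skew u ** skew u\<close> instead of the identity.\<close>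

lemma skew_funpow:
  assumes "norm u = 1"
  shows "(1 / fact n) *\<^sub>R (((\<lambda>X. (\<theta> *\<^sub>R skew u) ** X) ^^ n) (mat 1)) =
    (sin_coeff n * \<theta>^n) *\<^sub>R skew u - (cos_coeff n * \<theta>^n) *\<^sub>R (skew u ** skew u) +
    (if n = 0 then mat 1 + skew u ** skew u else 0)"
proof (cases n)
  case 0
  then show ?thesis by simp
next
  case (Suc m)
  have coeff: "sin_coeff (Suc n) = cos_coeff n / real (Suc n)"
    "cos_coeff (Suc n) = - sin_coeff n / real (Suc n)" for n
    by (rule sin_coeff_Suc, rule cos_coeff_Suc)
  have "(1 / fact (Suc m)) *\<^sub>R (((\<lambda>X. (\<theta> *\<^sub>R skew u) ** X) ^^ Suc m) (mat 1)) =
    (sin_coeff (Suc m) * \<theta>^Suc m) *\<^sub>R skew u - (cos_coeff (Suc m) * \<theta>^Suc m) *\<^sub>R (skew u ** skew u)"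
  proof (induction m)
    case 0
    then show ?case by (simp add: sin_coeff_def cos_coeff_def)
  next
    case (Suc m)
    have "(1 / fact (Suc (Suc m))) *\<^sub>R (((\<lambda>X. (\<theta> *\<^sub>R skew u) ** X) ^^ Suc (Suc m)) (mat 1)) =
      (1 / Suc (Suc m)) *\<^sub>R ((\<theta> *\<^sub>R skew u) **
        ((1 / fact (Suc m)) *\<^sub>R (((\<lambda>X. (\<theta> *\<^sub>R skew u) ** X) ^^ Suc m) (mat 1))))"
      by (simp add: matrix_mul.scaleR_left matrix_mul.scaleR_right del: of_nat_Suc)
    also have "\<dots> = (1 / Suc (Suc m)) *\<^sub>R ((\<theta> *\<^sub>R skew u) **
       ((sin_coeff (Suc m) * \<theta>^Suc m) *\<^sub>R skew u - (cos_coeff (Suc m) * \<theta>^Suc m) *\<^sub>R (skew u ** skew u)))"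
      unfolding Suc.IH ..
    also have "\<dots> = (sin_coeff (Suc (Suc m)) * \<theta>^Suc (Suc m)) *\<^sub>R skew u
       - (cos_coeff (Suc (Suc m)) * \<theta>^Suc (Suc m)) *\<^sub>R (skew u ** skew u)"
      unfolding coeff(1)[of "Suc m"] coeff(2)[of "Suc m"]
      by (simp add: matrix_mul.diff_right matrix_mul.scaleR_left matrix_mul.scaleR_right skew_cube[OF assms] algebra_simps
          del: of_nat_Suc)
    finally show ?case .
  qed
  then show ?thesis using Suc by simp
qed

lemma rot_axis_rodrigues:
  assumes "norm u = 1"
  shows "rot_axis \<theta> u = mat 1 + sin \<theta> *\<^sub>R skew u + (1 - cos \<theta>) *\<^sub>R (skew u ** skew u)"
proof -
  have "(\<lambda>n. sin_coeff n * \<theta>^n) sums sin \<theta>" "(\<lambda>n. cos_coeff n * \<theta>^n) sums cos \<theta>"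
    using sin_converges[of \<theta>] cos_converges[of \<theta>] by (simp_all add: real_scaleR_def)
  then have "(\<lambda>n. (1 / fact n) *\<^sub>R (((\<lambda>X. (\<theta> *\<^sub>R skew u) ** X) ^^ n) (mat 1))) sums
    (sin \<theta> *\<^sub>R skew u - cos \<theta> *\<^sub>R (skew u ** skew u) + (mat 1 + skew u ** skew u))"
    unfolding skew_funpow[OF assms]
    by (intro sums_add sums_diff sums_scaleR_left) (use sums_single[of 0 "\<lambda>_. mat 1 + skew u ** skew u"] in auto)
  then show ?thesis
    unfolding rot_axis_def matrix_exp_def by (simp add: sums_iff algebra_simps)
qed

text \<open>Half-angle formulas turn Rodrigues' formula into quaternion form, so that compositions
  with \<open>rot_axis\<close> reduce to \<open>quat_rot_mult\<close>.\<close>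

lemma rot_axis_quat_rot:
  assumes "norm u = 1"
  shows "rot_axis \<theta> u = quat_rot (cos (\<theta> / 2)) (sin (\<theta> / 2) *\<^sub>R u)"
proof -
  define c s where "c = cos (\<theta> / 2)" and "s = sin (\<theta> / 2)"
  have t: "sin \<theta> = 2 * s * c" "1 - cos \<theta> = 2 * s\<^sup>2" and cs: "c\<^sup>2 = 1 - s\<^sup>2"
    using sin_double[of "\<theta>/2"] cos_double_sin[of "\<theta>/2"] by (simp_all add: c_def s_def cos_squared_eq)
  have uu: "u \<bullet> u = 1" using assms by (simp add: norm_eq_1)
  have "(\<chi> i j. (s *\<^sub>R u)$i * (s *\<^sub>R u)$j) = s\<^sup>2 *\<^sub>R ((\<chi> i j. u$i * u$j) :: real^3^3)"
    by (simp add: vec_eq_iff power2_eq_square)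
  then show ?thesis
    unfolding rot_axis_rodrigues[OF assms] t c_def[symmetric] s_def[symmetric] quat_rot_def skew_square skew_scaleR
    by (simp add: vec_eq_iff cs uu) (simp add: algebra_simps power2_eq_square)
qed

lemma rot_axis_add:
  assumes "norm u = 1"
  shows "rot_axis s u ** rot_axis t u = rot_axis (s + t) u"
  using assms by (simp add: rot_axis_quat_rot quat_rot_mult norm_eq_1 cos_add sin_add add_divide_distrib
      cross_mult_left cross_mult_right algebra_simps)

lemma rot_axis_0: "norm u = 1 \<Longrightarrow> rot_axis 0 u = mat 1"
  by (simp add: rot_axis_rodrigues)

lemma rot_axis_SO3: "norm u = 1 \<Longrightarrow> rot_axis t u \<in> SO3"
  unfolding rot_axis_quat_rot
  by (rule quat_rot_SO3) (simp add: norm_eq_1 flip: power2_eq_square)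

lemma rot_axis_eigen: "norm u = 1 \<Longrightarrow> rot_axis t u *v u = u"
  by (simp add: rot_axis_rodrigues matrix_vector_mult_add_rdistrib scaleR_matrix_vector_assoc[symmetric]
      skew_mult_vec matrix_vector_mul_assoc[symmetric])

section \<open>Gradients on SO(3)\<close>

lemma tangent_SO3_skew: "R ** skew w \<in> tangent_SO3 R"
  unfolding tangent_SO3_def using transpose_skew by blast

lemma tangent_SO3E:
  assumes "X \<in> tangent_SO3 R"
  obtains w where "X = R ** skew w"
  using assms antisym_eq_skew unfolding tangent_SO3_def by blast

text \<open>A derivative within \<open>SO3\<close> is not unique on the whole matrix space. Along
  the curve \<open>R ** rot_axis t v\<close>, which stays in \<open>SO3\<close> and has velocity
  \<open>R ** skew v\<close> at 0, the chain rule reduces the claim to uniqueness of a derivative in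
  one real variable.\<close>

lemma has_derivative_SO3_unique:
  fixes f :: "real^3^3 \<Rightarrow> real"
  assumes R: "R \<in> SO3" and X: "X \<in> tangent_SO3 R"
    and D: "(f has_derivative D) (at R within SO3)" and D': "(f has_derivative D') (at R within SO3)"
  shows "D X = D' X"
proof -
  obtain w where w: "X = R ** skew w" by (rule tangent_SO3E[OF X])
  \<comment> \<open>Rodrigues' formula requires a unit axis; for \<open>w = 0\<close> any axis
    serves.\<close>
  obtain v where v: "norm v = 1" "w = norm w *\<^sub>R v"
  proof (cases "w = 0")
    case True
    then show thesis using that[of "axis 1 1"] by (simp add: norm_axis_1)
  next
    case False
    then show thesis using that[of "w /\<^sub>R norm w"] by simp
  qed
  define c where "c t = R ** rot_axis t v" for t
  have c0: "c 0 = R" by (simp add: c_def rot_axis_rodrigues[OF v(1)])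
  have cSO3: "range c \<subseteq> SO3"
    using v(1) R by (auto simp: c_def rot_axis_quat_rot norm_eq_1 power2_eq_square[symmetric]
        intro!: SO3_mult quat_rot_SO3)
  have dc: "(c has_derivative (\<lambda>t. t *\<^sub>R (R ** skew v))) (at 0)"
    unfolding c_def rot_axis_rodrigues[OF v(1)]
    by (rule has_derivative_eq_rhs[OF bounded_linear.has_derivative[OF matrix_mul.bounded_linear_right]])
      (auto intro!: derivative_eq_intros simp: matrix_mul.scaleR_right)
  have chain: "(f \<circ> c has_derivative F \<circ> (\<lambda>t. t *\<^sub>R (R ** skew v))) (at 0)"
    if "(f has_derivative F) (at R within SO3)" for F
    by (rule diff_chain_within[OF dc])
      (use that c0 cSO3 in \<open>auto intro: has_derivative_subset\<close>)
  have "D \<circ> (\<lambda>t. t *\<^sub>R (R ** skew v)) = D' \<circ> (\<lambda>t. t *\<^sub>R (R ** skew v))"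
    by (rule has_derivative_unique[OF chain[OF D] chain[OF D']])
  then have "D (norm w *\<^sub>R (R ** skew v)) = D' (norm w *\<^sub>R (R ** skew v))"
    by (metis comp_apply)
  then show ?thesis
    by (metis w v(2) skew_scaleR matrix_mul.scaleR_right)
qed

lemma metric_SO3_skew:
  assumes "R \<in> SO3"
  shows "metric_SO3 R (R ** skew g) (R ** skew w) = 2 * (g \<bullet> w)"
  by (simp add: metric_SO3_def matrix_mul_assoc SO3_transpose_mult[OF assms] trace_skew_skew)

lemma linear_skew_expansion:
  fixes D :: "real^3^3 \<Rightarrow> real"
  assumes "bounded_linear D"
  shows "D (R ** skew w) = (\<chi> i. D (R ** skew (axis i 1))) \<bullet> w"
proof -
  have "w = w$1 *\<^sub>R axis 1 1 + w$2 *\<^sub>R axis 2 1 + w$3 *\<^sub>R axis 3 1"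
    by (simp add: vec_eq_iff forall_3 axis_def)
  then have "skew w = w$1 *\<^sub>R skew (axis 1 1) + w$2 *\<^sub>R skew (axis 2 1) + w$3 *\<^sub>R skew (axis 3 1)"
    by (metis skew_add skew_scaleR)
  then show ?thesis
    using assms
    by (simp add: linear_simps matrix_mul.add_right matrix_mul.scaleR_right inner_vec_def sum_3)
qed

text \<open>The factor \<open>1/2\<close> compensates the factor 2 by which the metric exceeds the
  inner product of the axis vectors, see \<open>metric_SO3_skew\<close>.\<close>

lemma has_gradient_SO3I:
  assumes R: "R \<in> SO3" and D: "(f has_derivative D) (at R within SO3)"
  shows "has_gradient_SO3 f (R ** skew ((1/2) *\<^sub>R (\<chi> i. D (R ** skew (axis i 1))))) R"
  unfolding has_gradient_SO3_def
proof (intro conjI exI ballI)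
  fix X assume "X \<in> tangent_SO3 R"
  then obtain w where w: "X = R ** skew w" by (rule tangent_SO3E)
  show "D X = metric_SO3 R (R ** skew ((1/2) *\<^sub>R (\<chi> i. D (R ** skew (axis i 1))))) X"
    unfolding w metric_SO3_skew[OF R]
    by (subst linear_skew_expansion[OF has_derivative_bounded_linear[OF D]]) simp
qed (fact tangent_SO3_skew, fact D)

text \<open>The definition of the gradient only asks for some derivative; uniqueness on tangent
  vectors transfers the condition to the given \<open>D\<close>.\<close>

lemma has_zero_gradient_SO3_iff:
  assumes R: "R \<in> SO3" and D: "(f has_derivative D) (at R within SO3)"
  shows "has_gradient_SO3 f 0 R \<longleftrightarrow> (\<forall>w. D (R ** skew w) = 0)"
proof -
  have 0: "0 \<in> tangent_SO3 R"
    using tangent_SO3_skew[of R 0] skew_scaleR[of 0 0] by (simp add: matrix_mul.zero_right)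
  have "metric_SO3 R 0 X = 0" for X
    by (simp add: metric_SO3_def matrix_mul.zero_right matrix_mul.zero_left transpose_def trace_def)
      (simp add: matrix_matrix_mult_def)
  with 0 D show ?thesis
    unfolding has_gradient_SO3_def
    using has_derivative_SO3_unique[OF R] tangent_SO3_skew by (metis tangent_SO3E)
qed

text \<open>The coordinates of the gradient are derivatives along the left-invariant fields
  \<open>R ** skew w\<close>, so continuity along each of these suffices.\<close>

lemma C1_SO3I:
  assumes "\<And>R. R \<in> SO3 \<Longrightarrow> (f has_derivative D R) (at R within SO3)"
    and "\<And>w. continuous_on SO3 (\<lambda>R. D R (R ** skew w))"
  shows "C1_SO3 f"
  unfolding C1_SO3_def
proof (intro exI conjI ballI)
  show "has_gradient_SO3 f (R ** skew ((1/2) *\<^sub>R (\<chi> i. D R (R ** skew (axis i 1))))) R" if "R \<in> SO3" for R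
    using has_gradient_SO3I[OF that assms(1)[OF that]] .
  have skew: "continuous_on SO3 (\<lambda>R. skew (h R))" if "continuous_on SO3 h" for h
    unfolding skew_vector using that
    by (subst continuous_on_componentwise) 
      (auto intro!: continuous_intros simp: skew_vector Basis_vec_def forall_3 inner_axis)
  show "continuous_on SO3 (\<lambda>R. R ** skew ((1/2) *\<^sub>R (\<chi> i. D R (R ** skew (axis i 1)))))"
    by (intro bounded_bilinear.continuous_on[OF bounded_bilinear_matrix_mul] continuous_on_id skew
        continuous_on_scaleR continuous_on_const continuous_on_vec_lambda assms(2))
qed

lemma skew_conjugate:
  assumes "P \<in> SO3"
  shows "skew w ** P = P ** skew (transpose P *v w)"
proof -
  have P: "rotation_matrix P" "P ** transpose P = mat 1"
    using assms by (auto simp: SO3_def rotation_matrix_def orthogonal_matrix_def)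
  have "cross3 w (P *v x) = P *v cross3 (transpose P *v w) x" for x
    using cross_rotation_matrix[OF P(1)] by (metis P(2) matrix_vector_mul_assoc matrix_vector_mul_lid)
  then show ?thesis
    by (simp add: matrix_eq matrix_vector_mul_assoc[symmetric] skew_mult_vec)
qed

lemma bounded_linear_trace: "bounded_linear (trace :: real^'n^'n \<Rightarrow> real)"
  unfolding linear_conv_bounded_linear[symmetric]
  by (auto intro!: linearI simp: trace_def sum.distrib sum_distrib_left)

lemma bounded_linear_trace_mult: "bounded_linear (\<lambda>Y. trace (A ** (Y ** N)))" for A N :: "real^'n^'n"
  by (rule bounded_linear_compose[OF bounded_linear_trace
        bounded_linear_compose[OF matrix_mul.bounded_linear_right matrix_mul.bounded_linear_left]])

section \<open>Eigenframes and \<open>\<Delta>\<close>\<close>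

lemma W_mat_mult_vec: "W_mat A *v x = trace A *\<^sub>R x - A *v x"
  by (simp add: W_mat_def matrix_vector_mult_diff_rdistrib scaleR_matrix_vector_assoc[symmetric])

text \<open>The Binet-Cauchy identity, with Lagrange's identity as a special case.\<close>

lemma inner_cross_cross: "cross3 u v \<bullet> cross3 x y = (u \<bullet> x) * (v \<bullet> y) - (u \<bullet> y) * (v \<bullet> x)"
  by (simp add: cross3_def inner_vec_def sum_3) algebra

text \<open>The frame may have either orientation, so \<open>b k\<close> is the cross product of
  \<open>b i\<close> and \<open>b j\<close> only up to sign; squaring removes the sign.\<close>

lemma orthonormal_cross:
  fixes b :: "3 \<Rightarrow> real^3"
  assumes b: "\<And>i j. b i \<bullet> b j = (if i = j then 1 else 0)"
    and ijk: "i \<noteq> j" "j \<noteq> k" "i \<noteq> k"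
  shows "(cross3 u v \<bullet> b k)\<^sup>2 = ((u \<bullet> b i) * (v \<bullet> b j) - (u \<bullet> b j) * (v \<bullet> b i))\<^sup>2"
proof -
  define c where "c = cross3 (b i) (b j)"
  have ci: "c \<bullet> b i = 0" "c \<bullet> b j = 0" by (simp_all add: c_def dot_cross_self)
  have ex: "c = (c \<bullet> b k) *\<^sub>R b k"
    using orthonormal_expansion[OF b, of c] ci ijk exhaust_3[of i] exhaust_3[of j] exhaust_3[of k]
    by auto
  have "(c \<bullet> b k)\<^sup>2 = c \<bullet> c"
    by (subst (3) ex) (simp add: power2_eq_square)
  also have "\<dots> = 1" using ijk by (simp add: c_def inner_cross_cross b)
  finally have 1: "(c \<bullet> b k)\<^sup>2 = 1" .
  have "(cross3 u v \<bullet> c)\<^sup>2 = (c \<bullet> b k)\<^sup>2 * (cross3 u v \<bullet> b k)\<^sup>2"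
    by (subst ex) (simp add: power_mult_distrib)
  then show ?thesis using 1 by (simp add: c_def inner_cross_cross)
qed

text \<open>If a vector vanishes, both sides are 0, because division by zero gives 0 and
  \<open>cos (arccos 0) = 0\<close>.\<close>

lemma cos_vec_angle: "cos (vec_angle x y) = (x \<bullet> y) / (norm x * norm y)"
proof -
  have "\<bar>(x \<bullet> y) / (norm x * norm y)\<bar> \<le> 1"
    using Cauchy_Schwarz_ineq2[of x y] by (cases "x = 0 \<or> y = 0") (auto simp: abs_mult divide_le_eq_1)
  then show ?thesis by (simp add: vec_angle_def cos_arccos_abs)
qed

locale eigenframe_pd =
  fixes A :: "real^3^3" and l :: "3 \<Rightarrow> real" and b :: "3 \<Rightarrow> real^3"
  assumes frame: "eigenframe A l b" and W_pd: "sym_pos_def (W_mat A)"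
begin

abbreviation W where "W \<equiv> W_mat A"

abbreviation w where "w i \<equiv> trace A - l i"

lemma b: "b i \<bullet> b j = (if i = j then 1 else 0)"
  using frame by (simp add: eigenframe_def)

lemma norm_b [simp]: "norm (b i) = 1"
  by (simp add: norm_eq_1 b)

lemma A_b: "A *v b i = l i *\<^sub>R b i"
  using frame by (simp add: eigenframe_def)

lemma W_b: "W *v b i = w i *\<^sub>R b i"
  by (simp add: W_mat_mult_vec A_b scaleR_diff_left)

lemma A_inner_b: "(A *v x) \<bullet> b i = l i * (x \<bullet> b i)"
proof -
  have "A *v x = (x \<bullet> b 1) *\<^sub>R (A *v b 1) + (x \<bullet> b 2) *\<^sub>R (A *v b 2) + (x \<bullet> b 3) *\<^sub>R (A *v b 3)"
    using arg_cong[OF orthonormal_expansion[OF b, of x], of "(*v) A"]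
    by (simp add: matrix_vector_mult_scaleR matrix_vector_right_distrib)
  then show ?thesis
    using exhaust_3[of i] by (auto simp: A_b inner_add_left b)
qed

lemma W_inner_b: "(W *v x) \<bullet> b i = w i * (x \<bullet> b i)"
  by (simp add: W_mat_mult_vec inner_diff_left A_inner_b algebra_simps)

lemma W_sym: "x \<bullet> (W *v y) = (W *v x) \<bullet> y"
  unfolding orthonormal_inner[OF b, of x "W *v y"] orthonormal_inner[OF b, of "W *v x" y] W_inner_b
  by (simp add: mult_ac)

lemma W_quad: "x \<bullet> (W *v x) = w 1 * (x \<bullet> b 1)\<^sup>2 + w 2 * (x \<bullet> b 2)\<^sup>2 + w 3 * (x \<bullet> b 3)\<^sup>2"
  unfolding orthonormal_inner[OF b, of x "W *v x"] W_inner_b by (simp add: power2_eq_square mult_ac)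

lemma w_pos: "0 < w i"
proof -
  have "b i \<noteq> 0" using b[of i i] by auto
  then have "0 < b i \<bullet> (W *v b i)" using W_pd by (simp add: sym_pos_def_def)
  then show ?thesis by (simp only: W_b) (simp add: b)
qed

text \<open>Shows that the set behind \<open>lam_min\<close> and \<open>lam_max\<close> is finite
  and nonempty: some coordinate of an eigenvector is nonzero and fixes its eigenvalue.\<close>

lemma eigenvalues_W: "eigenvalues W = {w 1, w 2, w 3}"
proof
  have "b i \<noteq> 0" for i using norm_b[of i] by (metis norm_zero zero_neq_one)
  then have "w i \<in> eigenvalues W" for i
    unfolding eigenvalues_def using W_b[of i] by blast
  then show "{w 1, w 2, w 3} \<subseteq> eigenvalues W" by blast
  show "eigenvalues W \<subseteq> {w 1, w 2, w 3}"
  proof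
    fix c assume "c \<in> eigenvalues W"
    then obtain v where v: "v \<noteq> 0" "W *v v = c *\<^sub>R v" by (auto simp: eigenvalues_def)
    obtain i where "v \<bullet> b i \<noteq> 0"
      using orthonormal_expansion[OF b, of v] v(1) by fastforce
    then have "c = w i" using W_inner_b[of v i] v(2) by simp
    then show "c \<in> {w 1, w 2, w 3}" using exhaust_3[of i] by auto
  qed
qed

abbreviation Lmax where "Lmax \<equiv> lam_max W"
abbreviation Lmin where "Lmin \<equiv> lam_min W"

lemma w_le: "w i \<le> Lmax" and w_ge: "Lmin \<le> w i"
  unfolding lam_max_def lam_min_def eigenvalues_W using exhaust_3[of i] by auto

lemma Lmin_pos: "0 < Lmin"
proof -
  have "Lmin \<in> {w 1, w 2, w 3}"
    unfolding lam_min_def eigenvalues_W by (rule Min_in) auto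
  then show ?thesis using w_pos by auto
qed

lemma Lmin_le_Lmax: "Lmin \<le> Lmax"
  using w_le[of 1] w_ge[of 1] by linarith

lemma W_quad_le: "x \<bullet> (W *v x) \<le> Lmax * (x \<bullet> x)"
proof -
  have "w i * (x \<bullet> b i)\<^sup>2 \<le> Lmax * (x \<bullet> b i)\<^sup>2" for i
    using w_le by (intro mult_right_mono) auto
  from this[of 1] this[of 2] this[of 3] show ?thesis
    by (simp add: W_quad orthonormal_inner[OF b, of x x] power2_eq_square algebra_simps)
qed

lemma W_quad_ge: "Lmin * (x \<bullet> x) \<le> x \<bullet> (W *v x)"
proof -
  have "Lmin * (x \<bullet> b i)\<^sup>2 \<le> w i * (x \<bullet> b i)\<^sup>2" for i
    using w_ge by (intro mult_right_mono) auto
  from this[of 1] this[of 2] this[of 3] show ?thesis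
    by (simp add: W_quad orthonormal_inner[OF b, of x x] power2_eq_square algebra_simps)
qed

lemma W_sq_le: "(W *v x) \<bullet> (W *v x) \<le> Lmax\<^sup>2 * (x \<bullet> x)"
proof -
  have "(w i)\<^sup>2 * (x \<bullet> b i)\<^sup>2 \<le> Lmax\<^sup>2 * (x \<bullet> b i)\<^sup>2" for i
    using w_le[of i] w_pos[of i] by (intro mult_right_mono power_mono) auto
  from this[of 1] this[of 2] this[of 3] show ?thesis
    by (simp add: orthonormal_inner[OF b, of x x] orthonormal_inner[OF b, of "W *v x" "W *v x"]
        W_inner_b power2_eq_square algebra_simps)
qed

lemma W_nonsing: "W *v x = 0 \<longleftrightarrow> x = 0"
proof
  assume "W *v x = 0"
  then have "Lmin * (x \<bullet> x) \<le> 0" using W_quad_ge[of x] by simp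
  then have "x \<bullet> x \<le> 0" using Lmin_pos by (simp add: mult_le_0_iff)
  then show "x = 0" by (metis inner_gt_zero_iff not_le)
qed simp

section \<open>Unit eigenvectors of \<open>A\<close> as eigenvectors of \<open>W\<close>\<close>

lemma unit_eigenvector_W:
  assumes "v \<in> unit_eigenvectors A"
  shows "W *v v = (v \<bullet> (W *v v)) *\<^sub>R v"
proof -
  obtain c where "norm v = 1" "A *v v = c *\<^sub>R v" using assms by (auto simp: unit_eigenvectors_def)
  then show ?thesis
    by (simp add: W_mat_mult_vec inner_diff_right norm_eq_1 scaleR_diff_left)
qed

lemma unit_eigenvectorI:
  assumes "norm v = 1" "W *v v = c *\<^sub>R v"
  shows "v \<in> unit_eigenvectors A"
proof -
  have "A *v v = (trace A - c) *\<^sub>R v"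
    using assms(2) by (simp add: W_mat_mult_vec algebra_simps)
  then show ?thesis using assms(1) by (auto simp: unit_eigenvectors_def)
qed

lemma eigenvalue_of_W:
  assumes "v \<in> unit_eigenvectors A"
  shows "eigenvalue_of W v = v \<bullet> (W *v v)"
  unfolding eigenvalue_of_def
proof (rule the_equality)
  show "W *v v = (v \<bullet> (W *v v)) *\<^sub>R v" by (rule unit_eigenvector_W[OF assms])
  show "c = v \<bullet> (W *v v)" if "W *v v = c *\<^sub>R v" for c
    using that assms by (simp add: unit_eigenvectors_def norm_eq_1)
qed

lemma eigenvalue_W_bounds:
  assumes "v \<in> unit_eigenvectors A"
  shows "0 < v \<bullet> (W *v v)" "v \<bullet> (W *v v) \<le> Lmax"
proof -
  have "v \<bullet> v = 1" using assms by (simp add: unit_eigenvectors_def norm_eq_1)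
  then show "0 < v \<bullet> (W *v v)" "v \<bullet> (W *v v) \<le> Lmax"
    using W_quad_ge[of v] W_quad_le[of v] Lmin_pos by auto
qed

text \<open>With the Rayleigh quotient in place of the unknown eigenvalue, being an eigenvector is a
  closed condition on the sphere. Compactness provides the minima in the theorem.\<close>

lemma compact_unit_eigenvectors: "compact (unit_eigenvectors A)"
proof -
  have "unit_eigenvectors A = sphere 0 1 \<inter> {v. W *v v = (v \<bullet> (W *v v)) *\<^sub>R v}"
    using unit_eigenvector_W unit_eigenvectorI by (auto simp: unit_eigenvectors_def)
  moreover have "closed {v. W *v v = (v \<bullet> (W *v v)) *\<^sub>R v}"
    by (intro closed_Collect_eq continuous_intros matrix_vector_mult_linear_continuous_on)
  ultimately show ?thesis by (simp add: compact_Int_closed)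
qed

lemma b_unit_eigenvector: "b i \<in> unit_eigenvectors A"
  using A_b by (auto simp: unit_eigenvectors_def)

lemma unit_eigenvector_coords:
  assumes "v \<in> unit_eigenvectors A"
  shows "w i * (v \<bullet> b i) = (v \<bullet> (W *v v)) * (v \<bullet> b i)"
  by (metis W_inner_b unit_eigenvector_W[OF assms] inner_scaleR_left)

lemma eq_pm_b:
  assumes "norm v = 1" and "\<forall>j. j \<noteq> i \<longrightarrow> v \<bullet> b j = 0"
  shows "v = b i \<or> v = - b i"
proof -
  have v: "(v \<bullet> b i) *\<^sub>R b i = v"
    using orthonormal_expansion[OF b, of v, symmetric] assms(2) exhaust_3[of i] by (auto simp: forall_3)
  have "norm ((v \<bullet> b i) *\<^sub>R b i) = 1" unfolding v by (fact assms(1))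
  then have "v \<bullet> b i = 1 \<or> v \<bullet> b i = - 1" by (simp add: abs_if split: if_splits)
  then show ?thesis by (rule disj_forward; use v in simp)
qed

text \<open>A form of \<open>Delta\<close> without cases and without a frame, visibly continuous in
  \<open>v\<close>.\<close>

definition Delta_quad where "Delta_quad u v = v \<bullet> (W *v v) - cross3 u v \<bullet> (W *v cross3 u v)"

lemma Delta_eq:
  assumes v: "v \<in> unit_eigenvectors A" and u: "norm u = 1"
  shows "Delta A l b v u = Delta_quad u v"
proof -
  define p q r where "p = u \<bullet> b 1" and "q = u \<bullet> b 2" and "r = u \<bullet> b 3"
  define x y z where "x = v \<bullet> b 1" and "y = v \<bullet> b 2" and "z = v \<bullet> b 3"
  have nv: "norm v = 1" using v by (simp add: unit_eigenvectors_def)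
  have pqr: "p\<^sup>2 + q\<^sup>2 + r\<^sup>2 = 1"
    using u orthonormal_inner[OF b, of u u] by (simp add: norm_eq_1 p_def q_def r_def power2_eq_square)
  have xyz: "x\<^sup>2 + y\<^sup>2 + z\<^sup>2 = 1"
    using nv orthonormal_inner[OF b, of v v] by (simp add: norm_eq_1 x_def y_def z_def power2_eq_square)
  have uv: "u \<bullet> v = p * x + q * y + r * z"
    by (simp add: orthonormal_inner[OF b, of u v] p_def q_def r_def x_def y_def z_def)
  have D: "Delta_quad u v = w 1 * x\<^sup>2 + w 2 * y\<^sup>2 + w 3 * z\<^sup>2 -
      (w 1 * (q * z - r * y)\<^sup>2 + w 2 * (p * z - r * x)\<^sup>2 + w 3 * (p * y - q * x)\<^sup>2)"
    using orthonormal_cross[where b = b and i = 2 and j = 3 and k = 1, OF b]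
      orthonormal_cross[where b = b and i = 1 and j = 3 and k = 2, OF b]
      orthonormal_cross[where b = b and i = 1 and j = 2 and k = 3, OF b]
    by (simp add: Delta_quad_def W_quad p_def q_def r_def x_def y_def z_def)
  consider (1) "l 1 = l 2" "l 2 = l 3" | (2) "l 1 = l 2" "l 2 \<noteq> l 3" | (3) "l 1 < l 2" "l 2 < l 3"
    using frame by (auto simp: eigenframe_def)
  then show ?thesis
  proof cases
    case 1
    have "Delta A l b v u = w 3 * (p * x + q * y + r * z)\<^sup>2"
      using 1 u nv by (simp add: Delta_def cos_vec_angle uv)
    \<comment> \<open>Lagrange's identity in coordinates: with equal eigenvalues only the length of
      \<open>u \<times> v\<close> matters.\<close>
    moreover have "(q * z - r * y)\<^sup>2 + (p * z - r * x)\<^sup>2 + (p * y - q * x)\<^sup>2 =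
        (p\<^sup>2 + q\<^sup>2 + r\<^sup>2) * (x\<^sup>2 + y\<^sup>2 + z\<^sup>2) - (p * x + q * y + r * z)\<^sup>2"
      by algebra
    then have "Delta_quad u v = w 3 * (x\<^sup>2 + y\<^sup>2 + z\<^sup>2) - w 3 * (1 - (p * x + q * y + r * z)\<^sup>2)"
      unfolding D 1 distrib_left[symmetric] by (simp add: pqr xyz)
    ultimately show ?thesis by (simp only: xyz) (simp add: right_diff_distrib)
  next
    case 2
    show ?thesis
    proof (cases "v = b 3 \<or> v = - b 3")
      case True
      then have "x = 0" "y = 0" by (auto simp: x_def y_def b)
      then have "Delta_quad u v = w 3 - w 2 * (1 - r\<^sup>2)" using pqr xyz
        by (simp add: D 2 power_mult_distrib flip: distrib_left)
      then show ?thesis using 2 True by (simp add: Delta_def r_def)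
    next
      case False
      \<comment> \<open>A nonzero \<open>z\<close> would force the simple eigenvalue
        \<open>w 3\<close>, hence \<open>v\<close> would be \<open>b 3\<close> or
        \<open>- b 3\<close>.\<close>
      have z: "z = 0"
      proof (rule ccontr)
        assume "z \<noteq> 0"
        then have "v \<bullet> (W *v v) = w 3" using unit_eigenvector_coords[OF v, of 3] by (simp add: z_def)
        then have "v \<bullet> b 1 = 0" "v \<bullet> b 2 = 0"
          using unit_eigenvector_coords[OF v, of 1] unit_eigenvector_coords[OF v, of 2] 2 by auto
        then show False using eq_pm_b[OF nv, of 3] False by (simp add: forall_3)
      qed
      let ?a = "p *\<^sub>R b 1 + q *\<^sub>R b 2"
      have va: "v \<bullet> ?a = p * x + q * y" by (simp add: inner_add_right x_def y_def)
      have na: "(norm ?a)\<^sup>2 = p\<^sup>2 + q\<^sup>2"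
        unfolding power2_norm_eq_inner by (simp add: inner_add_left inner_add_right b power2_eq_square)
      \<comment> \<open>The factor \<open>1 - r^2 = p^2 + q^2\<close> is the squared length of the
        projection \<open>?a\<close> of \<open>u\<close>, which clears the denominator of the
        cosine; if \<open>?a\<close> vanishes, both sides are 0.\<close>
      have "(1 - r\<^sup>2) * (sin (vec_angle v ?a))\<^sup>2 = (p * y - q * x)\<^sup>2"
      proof (cases "p\<^sup>2 + q\<^sup>2 = 0")
        case True
        then have "p = 0" "q = 0" by (simp_all add: sum_power2_eq_zero_iff)
        moreover have "1 - r\<^sup>2 = 0" using pqr True by linarith
        ultimately show ?thesis by simp
      next
        case False
        have "(1 - r\<^sup>2) * (sin (vec_angle v ?a))\<^sup>2 = (p\<^sup>2 + q\<^sup>2) * (1 - (p * x + q * y)\<^sup>2 / (p\<^sup>2 + q\<^sup>2))"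
          using pqr by (simp add: sin_squared_eq cos_vec_angle va nv power_divide na)
        also have "\<dots> = (p\<^sup>2 + q\<^sup>2) - (p * x + q * y)\<^sup>2" using False by (simp add: field_simps)
        also have "\<dots> = (p\<^sup>2 + q\<^sup>2) * (x\<^sup>2 + y\<^sup>2) - (p * x + q * y)\<^sup>2" using xyz z by simp
        also have "\<dots> = (p * y - q * x)\<^sup>2" by algebra
        finally show ?thesis .
      qed
      moreover have "Delta A l b v u = (1 - r\<^sup>2) * (w 2 - w 3 * (sin (vec_angle v ?a))\<^sup>2)"
        using 2 False by (simp add: Delta_def p_def q_def r_def)
      ultimately have "Delta A l b v u = (1 - r\<^sup>2) * w 2 - w 3 * (p * y - q * x)\<^sup>2"
        by (simp add: right_diff_distrib mult.left_commute)
      moreover have "Delta_quad u v = (1 - r\<^sup>2) * (w 2 * (x\<^sup>2 + y\<^sup>2)) - w 3 * (p * y - q * x)\<^sup>2"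
        by (simp add: D z 2 power2_eq_square algebra_simps)
      moreover have "x\<^sup>2 + y\<^sup>2 = 1" using xyz z by simp
      ultimately show ?thesis by simp
    qed
  next
    case 3
    have ww: "w 1 \<noteq> w 2" "w 2 \<noteq> w 3" "w 1 \<noteq> w 3" using 3 by auto
    have co: "w 1 * x = (v \<bullet> (W *v v)) * x" "w 2 * y = (v \<bullet> (W *v v)) * y" "w 3 * z = (v \<bullet> (W *v v)) * z"
      using unit_eigenvector_coords[OF v] by (simp_all add: x_def y_def z_def)
    \<comment> \<open>Two nonzero coordinates would force two of the distinct eigenvalues to
      agree.\<close>
    consider "y = 0" "z = 0" | "x = 0" "z = 0" | "x = 0" "y = 0"
      using co ww unfolding mult_cancel_right by metis
    then show ?thesis
    proof cases
      case A: 1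
      then have "v = b 1 \<or> v = - b 1"
        by (intro eq_pm_b[OF nv]) (simp add: forall_3 flip: x_def y_def z_def)
      then have "Delta A l b v u = w 1 - q\<^sup>2 * w 3 - r\<^sup>2 * w 2"
        using 3 by (simp add: Delta_def q_def r_def)
      moreover have "x\<^sup>2 = 1" using xyz A by simp
      ultimately show ?thesis by (simp add: D A power_mult_distrib)
    next
      case A: 2
      then have "v = b 2 \<or> v = - b 2"
        by (intro eq_pm_b[OF nv]) (simp add: forall_3 flip: x_def y_def z_def)
      moreover have "\<not> (v = b 1 \<or> v = - b 1)" using A by (auto simp: x_def b)
      ultimately have "Delta A l b v u = w 2 - r\<^sup>2 * w 1 - p\<^sup>2 * w 3"
        using 3 by (simp add: Delta_def p_def r_def)
      moreover have "y\<^sup>2 = 1" using xyz A by simp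
      ultimately show ?thesis by (simp add: D A power_mult_distrib)
    next
      case A: 3
      then have v: "v = b 3 \<or> v = - b 3"
        by (intro eq_pm_b[OF nv]) (simp add: forall_3 flip: x_def y_def z_def)
      then have "\<not> (v = b 1 \<or> v = - b 1)" "\<not> (v = b 2 \<or> v = - b 2)"
        using A by (auto simp: x_def y_def b)
      then have "Delta A l b v u = w 3 - p\<^sup>2 * w 2 - q\<^sup>2 * w 1"
        using 3 by (simp add: Delta_def p_def q_def)
      moreover have "z\<^sup>2 = 1" using xyz A by simp
      ultimately show ?thesis by (simp add: D A power_mult_distrib)
    qed
  qed
qed

end

section \<open>Monotonicity of \<open>\<sigma>\<close>\<close>

lemma V_bar_root:
  assumes "k \<noteq> 0" "0 < lam" "0 < D"
  shows "0 < V_bar k lam D" "2 * k\<^sup>2 * D * (V_bar k lam D)\<^sup>2 + V_bar k lam D = 2 * lam"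
proof -
  define s where "s = sqrt (1 + 16 * lam * k\<^sup>2 * D)"
  define c where "c = 4 * k\<^sup>2 * D"
  have c: "0 < c" using assms by (simp add: c_def)
  have s: "s\<^sup>2 = 1 + 4 * lam * c" "1 < s" using assms by (simp_all add: s_def c_def)
  have V: "V_bar k lam D = (s - 1) / c" by (simp add: V_bar_def s_def c_def)
  show "0 < V_bar k lam D" using s(2) c by (simp add: V)
  have "c * ((s - 1) / c)\<^sup>2 / 2 + (s - 1) / c = (s\<^sup>2 - 1) / (2 * c)"
    using c by (simp add: field_simps power2_eq_square)
  also have "\<dots> = 2 * lam" using c by (simp add: s)
  finally show "2 * k\<^sup>2 * D * (V_bar k lam D)\<^sup>2 + V_bar k lam D = 2 * lam"
    by (simp add: V c_def mult_ac)
qed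

lemma quadratic_less_mono:
  assumes "0 \<le> c" "0 \<le> x" "x < (y::real)"
  shows "c * x\<^sup>2 + x < c * y\<^sup>2 + y"
  using assms by (intro add_le_less_mono mult_left_mono power_mono) auto

text \<open>The left side of the quadratic equation is strictly increasing on nonnegative
  arguments.\<close>

lemma V_bar_unique:
  assumes "k \<noteq> 0" "0 < lam" "0 < D" "0 \<le> V" "2 * k\<^sup>2 * D * V\<^sup>2 + V = 2 * lam"
  shows "V = V_bar k lam D"
proof -
  have "0 \<le> 2 * k\<^sup>2 * D" using assms by simp
  from quadratic_less_mono[OF this, of V "V_bar k lam D"] quadratic_less_mono[OF this, of "V_bar k lam D" V]
  show ?thesis using V_bar_root[OF assms(1-3)] assms(4,5) by (cases V "V_bar k lam D" rule: linorder_cases) auto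
qed

lemma V_bar_le:
  assumes "k \<noteq> 0" "0 < lam" "0 < D"
  shows "V_bar k lam D \<le> 2 * lam"
proof -
  have "0 \<le> 2 * k\<^sup>2 * D * (V_bar k lam D)\<^sup>2" using assms by simp
  then show ?thesis using V_bar_root(2)[OF assms] by linarith
qed

text \<open>Up to \<open>1/2\<close> the function \<open>t (1 - t)\<close> increases, which is what
  the monotonicity of \<open>gap_sigma\<close> in \<open>lam\<close> rests on. The bound follows
  from \<open>V_bar k lam D \<le> 2 * lam\<close>.\<close>

lemma V_bar_sq_le:
  assumes "k \<noteq> 0" "0 < lam" "0 < D" "8 * k\<^sup>2 * lam\<^sup>2 \<le> 1"
  shows "k\<^sup>2 * (V_bar k lam D)\<^sup>2 \<le> 1 / 2"
proof -
  have "(V_bar k lam D)\<^sup>2 \<le> (2 * lam)\<^sup>2"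
    using V_bar_le[OF assms(1-3)] V_bar_root(1)[OF assms(1-3)] by (intro power_mono) auto
  then have "k\<^sup>2 * (V_bar k lam D)\<^sup>2 \<le> k\<^sup>2 * (2 * lam)\<^sup>2" by (intro mult_left_mono) auto
  then show ?thesis using assms(4) by (simp add: power_mult_distrib)
qed

text \<open>The quadratic equation eliminates the explicit \<open>D\<close>, so that
  \<open>D\<close> enters only through \<open>V_bar\<close>.\<close>

lemma gap_sigma_eq:
  assumes "k \<noteq> 0" "0 < lam" "0 < D"
  shows "gap_sigma k lam D = 4 * (2 * lam - V_bar k lam D) * (1 - k\<^sup>2 * (V_bar k lam D)\<^sup>2)"
proof -
  have "2 * k\<^sup>2 * (V_bar k lam D)\<^sup>2 * D = 2 * lam - V_bar k lam D"
    using V_bar_root(2)[OF assms] by (simp add: algebra_simps)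
  then show ?thesis unfolding gap_sigma_def by algebra
qed

lemma gap_sigma_pos:
  assumes "k \<noteq> 0" "0 < lam" "0 < D" "8 * k\<^sup>2 * lam\<^sup>2 \<le> 1"
  shows "0 < gap_sigma k lam D"
  unfolding gap_sigma_def using V_bar_sq_le[OF assms] V_bar_root(1)[OF assms(1-3)] assms(1,3)
  by (intro mult_pos_pos) auto

text \<open>By its quadratic equation \<open>V_bar\<close> grows with \<open>lam\<close>, and
  \<open>gap_sigma\<close> is \<open>8 D t (1 - t)\<close> with
  \<open>t = k^2 V_bar^2 \<le> 1/2\<close>.\<close>

lemma gap_sigma_mono_lam:
  assumes k: "k \<noteq> 0" and lam: "0 < lam" "lam \<le> lam'" and D: "0 < D" and small: "8 * k\<^sup>2 * lam'\<^sup>2 \<le> 1"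
  shows "gap_sigma k lam D \<le> gap_sigma k lam' D"
proof -
  let ?V = "V_bar k lam D" and ?V' = "V_bar k lam' D"
  have lam': "0 < lam'" using lam by simp
  note V = V_bar_root[OF k lam(1) D] and V' = V_bar_root[OF k lam' D]
  have "?V \<le> ?V'"
  proof (rule ccontr)
    assume "\<not> ?V \<le> ?V'"
    then have "2 * k\<^sup>2 * D * ?V'\<^sup>2 + ?V' < 2 * k\<^sup>2 * D * ?V\<^sup>2 + ?V"
      using D V'(1) by (intro quadratic_less_mono) auto
    then show False using V(2) V'(2) lam by linarith
  qed
  then have "k\<^sup>2 * ?V\<^sup>2 \<le> k\<^sup>2 * ?V'\<^sup>2" using V(1) by (intro mult_left_mono power_mono) auto
  moreover have "k\<^sup>2 * ?V'\<^sup>2 \<le> 1 / 2" by (rule V_bar_sq_le[OF k lam' D small])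
  \<comment> \<open>The difference of the two sides factors as
    \<open>(t' - t) (1 - t - t')\<close>.\<close>
  moreover have "t * (1 - t) \<le> t' * (1 - t')" if "t \<le> t'" "t' \<le> 1 / 2" for t t' :: real
    using mult_nonneg_nonneg[of "t' - t" "1 - t - t'"] that by (simp add: algebra_simps)
  ultimately have "(8 * D) * (k\<^sup>2 * ?V\<^sup>2 * (1 - k\<^sup>2 * ?V\<^sup>2)) \<le> (8 * D) * (k\<^sup>2 * ?V'\<^sup>2 * (1 - k\<^sup>2 * ?V'\<^sup>2))"
    using D by (intro mult_left_mono) auto
  then show ?thesis by (simp add: gap_sigma_def mult_ac)
qed

text \<open>\<open>V_bar\<close> decreases in \<open>D\<close>, and both factors in
  \<open>gap_sigma_eq\<close> are nonnegative and decreasing in \<open>V_bar\<close>.\<close>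

lemma gap_sigma_mono_D:
  assumes k: "k \<noteq> 0" and lam: "0 < lam" and D: "0 < D" "D \<le> D'" and small: "8 * k\<^sup>2 * lam\<^sup>2 \<le> 1"
  shows "gap_sigma k lam D \<le> gap_sigma k lam D'"
proof -
  let ?V = "V_bar k lam D" and ?V' = "V_bar k lam D'"
  have D': "0 < D'" using D by simp
  note V = V_bar_root[OF k lam D(1)] and V' = V_bar_root[OF k lam D']
  have le: "?V' \<le> ?V"
  proof (rule ccontr)
    assume "\<not> ?V' \<le> ?V"
    then have "2 * k\<^sup>2 * D * ?V\<^sup>2 + ?V < 2 * k\<^sup>2 * D * ?V'\<^sup>2 + ?V'"
      using D V(1) by (intro quadratic_less_mono) auto
    also have "\<dots> \<le> 2 * k\<^sup>2 * D' * ?V'\<^sup>2 + ?V'"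
      using D by (intro add_right_mono mult_right_mono mult_left_mono) auto
    finally show False using V(2) V'(2) by linarith
  qed
  then have "k\<^sup>2 * ?V'\<^sup>2 \<le> k\<^sup>2 * ?V\<^sup>2" using V'(1) by (intro mult_left_mono power_mono) auto
  moreover have "k\<^sup>2 * ?V\<^sup>2 \<le> 1 / 2" by (rule V_bar_sq_le[OF k lam D(1) small])
  ultimately have "(2 * lam - ?V) * (1 - k\<^sup>2 * ?V\<^sup>2) \<le> (2 * lam - ?V') * (1 - k\<^sup>2 * ?V'\<^sup>2)"
    using le V_bar_le[OF k lam D(1)] by (intro mult_mono) auto
  then show ?thesis
    unfolding gap_sigma_eq[OF k lam D(1)] gap_sigma_eq[OF k lam D'] mult.assoc by (rule mult_left_mono) simp
qed

section \<open>The warped potential\<close>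

lemma V_pot_expand: "V_pot A R = trace A - trace (A ** R)"
  by (simp add: V_pot_def matrix_mul.diff_right trace_sub)

text \<open>The differential of \<open>warp_angle A k\<close> at \<open>R\<close> in the direction
  \<open>Y\<close>.\<close>

definition warp_rate :: "real^3^3 \<Rightarrow> real \<Rightarrow> real^3^3 \<Rightarrow> real^3^3 \<Rightarrow> real" where
  "warp_rate A k R Y = - 2 * k * trace (A ** Y) / sqrt (1 - (k * V_pot A R)\<^sup>2)"

lemma warp_rate_linear:
  "warp_rate A k R (Y + Z) = warp_rate A k R Y + warp_rate A k R Z"
  "warp_rate A k R (c *\<^sub>R Y) = c * warp_rate A k R Y"
  by (simp_all add: warp_rate_def matrix_mul.add_right matrix_mul.scaleR_right
      linear_simps[OF bounded_linear_trace] add_divide_distrib[symmetric] algebra_simps)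

text \<open>\<open>Gamma_warp\<close> for a single gain, so that both values of \<open>q\<close> are
  covered by the same lemmas.\<close>

definition warp :: "real^3^3 \<Rightarrow> real^3 \<Rightarrow> real \<Rightarrow> real^3^3 \<Rightarrow> real^3^3" where
  "warp A u k R = R ** rot_axis (warp_angle A k R) u"

text \<open>The product rule for \<open>V_pot A (warp A u k R)\<close>: the first term varies the
  factor \<open>R\<close>, the second varies the angle.\<close>

definition warp_deriv :: "real^3^3 \<Rightarrow> real^3 \<Rightarrow> real \<Rightarrow> real^3^3 \<Rightarrow> real^3^3 \<Rightarrow> real" where
  "warp_deriv A u k R Y = - trace (A ** (Y ** rot_axis (warp_angle A k R) u))
     - trace (A ** (warp A u k R ** skew u)) * warp_rate A k R Y"

text \<open>Separates the angle from \<open>Y\<close>: the coefficients are trigonometric in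
  \<open>t\<close>, the traces linear in \<open>Y\<close>, and both are easy to
  differentiate.\<close>

lemma trace_rodrigues:
  assumes "norm u = 1"
  shows "trace (A ** (Y ** rot_axis t u)) = trace (A ** (Y ** mat 1)) + sin t * trace (A ** (Y ** skew u))
      + (1 - cos t) * trace (A ** (Y ** (skew u ** skew u)))"
    and "trace (A ** ((Y ** rot_axis t u) ** skew u)) = cos t * trace (A ** (Y ** skew u))
      + sin t * trace (A ** (Y ** (skew u ** skew u)))"
proof -
  show "trace (A ** (Y ** rot_axis t u)) = trace (A ** (Y ** mat 1)) + sin t * trace (A ** (Y ** skew u))
      + (1 - cos t) * trace (A ** (Y ** (skew u ** skew u)))"
    by (simp add: rot_axis_rodrigues[OF assms] matrix_mul.add_right matrix_mul.scaleR_right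
        linear_simps[OF bounded_linear_trace])
  have "rot_axis t u ** skew u = cos t *\<^sub>R skew u + sin t *\<^sub>R (skew u ** skew u)"
    by (simp add: rot_axis_rodrigues[OF assms] matrix_mul.add_left matrix_mul.diff_left matrix_mul.scaleR_left
        skew_cube[OF assms] matrix_mul_assoc[symmetric] scaleR_diff_left)
  then show "trace (A ** ((Y ** rot_axis t u) ** skew u)) = cos t * trace (A ** (Y ** skew u))
      + sin t * trace (A ** (Y ** (skew u ** skew u)))"
    by (simp add: matrix_mul_assoc[symmetric] matrix_mul.add_right matrix_mul.scaleR_right
        linear_simps[OF bounded_linear_trace])
qed

lemma V_pot_warp_has_derivative:
  assumes u: "norm u = 1" and dom: "\<bar>k * V_pot A R\<bar> < 1"
  shows "((\<lambda>R. V_pot A (warp A u k R)) has_derivative warp_deriv A u k R) (at R)"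
proof -
  define T where "T N Y = trace (A ** (Y ** N))" for N Y :: "real^3^3"
  have dT: "(T N has_derivative T N) (at R)" for N
    unfolding T_def by (rule bounded_linear.has_derivative[OF bounded_linear_trace_mult has_derivative_ident])
  have V: "V_pot A Y = trace A - T (mat 1) Y" for Y
    by (simp add: V_pot_expand T_def)
  have rate: "warp_rate A k R Y = - 2 * k * T (mat 1) Y / sqrt (1 - (k * V_pot A R)\<^sup>2)" for Y
    by (simp add: warp_rate_def T_def)
  have dom': "\<bar>k * (trace A - T (mat 1) R)\<bar> < 1" using dom by (simp add: V)
  have dt: "(warp_angle A k has_derivative warp_rate A k R) (at R)"
    unfolding warp_angle_def V rate
    by (rule has_derivative_eq_rhs[OF has_derivative_mult_right[OF DERIV_compose_FDERIV[OF DERIV_arcsin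
            has_derivative_mult_right[OF has_derivative_diff[OF has_derivative_const dT]]]]])
      (use dom' in \<open>auto simp: divide_inverse abs_less_iff algebra_simps\<close>)
  have f: "(\<lambda>R. V_pot A (warp A u k R)) = (\<lambda>R. trace A - (T (mat 1) R + sin (warp_angle A k R) * T (skew u) R
      + (1 - cos (warp_angle A k R)) * T (skew u ** skew u) R))"
    by (simp add: V_pot_expand warp_def trace_rodrigues[OF u] T_def)
  have D: "warp_deriv A u k R = (\<lambda>Y. - (T (mat 1) Y + sin (warp_angle A k R) * T (skew u) Y
      + (1 - cos (warp_angle A k R)) * T (skew u ** skew u) Y)
      - (cos (warp_angle A k R) * T (skew u) R + sin (warp_angle A k R) * T (skew u ** skew u) R) * warp_rate A k R Y)"
    by (simp add: fun_eq_iff warp_deriv_def warp_def trace_rodrigues[OF u] T_def)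
  show ?thesis
    unfolding f D
    by (rule has_derivative_eq_rhs, (rule derivative_intros dT dt)+)
      (auto simp: algebra_simps)
qed

text \<open>Moving \<open>skew w\<close> past the rotation by \<open>skew_conjugate\<close> exhibits
  the derivative as that of \<open>V_pot A\<close> at the warped point, in a transported
  direction.\<close>

lemma warp_deriv_skew:
  assumes "norm u = 1"
  shows "warp_deriv A u k R (R ** skew w) = - trace (A ** (warp A u k R **
    skew (transpose (rot_axis (warp_angle A k R) u) *v w + warp_rate A k R (R ** skew w) *\<^sub>R u)))"
  using skew_conjugate[OF rot_axis_SO3[OF assms]]
  by (simp add: warp_deriv_def warp_def skew_add skew_scaleR matrix_mul.add_right matrix_mul.scaleR_right
      linear_simps[OF bounded_linear_trace] matrix_mul_assoc[symmetric])

text \<open>Used with \<open>x = e \<bullet> e\<close> and \<open>y = \<xi>^2\<close>. The bound 5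
  is immediate; for the other, \<open>6 - 4 y\<close> minus the left side is a combination of
  nonnegative terms with weights \<open>1 - y\<close> and \<open>y\<close>.\<close>

lemma warp_bound_ineq:
  fixes x y :: real
  assumes "0 \<le> x" "x \<le> 1" "0 \<le> y" "y \<le> 1"
  shows "4 * x - 3 * y * x\<^sup>2 \<le> 6 - max 1 (4 * y)"
proof -
  have "0 \<le> y * x\<^sup>2" using assms by simp
  then have "4 * x - 3 * y * x\<^sup>2 \<le> 5" using assms by linarith
  moreover have "0 \<le> (1 - y) * (6 - 4 * x) + y * (2 * (1 - x)\<^sup>2 + x\<^sup>2)"
    using assms by (intro add_nonneg_nonneg mult_nonneg_nonneg) auto
  then have "4 * x - 3 * y * x\<^sup>2 \<le> 6 - 4 * y" by (simp add: algebra_simps power2_eq_square)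
  ultimately show ?thesis by (simp add: max_def)
qed

text \<open>The bound on the gain is stated in squared form, so it is the same for \<open>k\<close>
  and \<open>- k\<close>.\<close>

locale warped_potential = eigenframe_pd +
  fixes u :: "real^3" and k :: real
  assumes u: "norm u = 1" and A_sym: "transpose A = A" and k0: "k \<noteq> 0"
    and k_bound: "4 * k\<^sup>2 * Lmax\<^sup>2 * (6 - max 1 (4 * (Lmin / Lmax)\<^sup>2)) < 1"
begin

lemma xi: "0 \<le> (Lmin / Lmax)\<^sup>2" "(Lmin / Lmax)\<^sup>2 \<le> 1"
  using Lmin_pos Lmin_le_Lmax by (auto intro!: power_le_one)

text \<open>As \<open>4 \<xi>^2 \<le> 4\<close>, the factor \<open>6 - max 1 (4 \<xi>^2)\<close> is
  at least 2.\<close>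

lemma k_small: "8 * k\<^sup>2 * Lmax\<^sup>2 < 1"
proof -
  have "4 * k\<^sup>2 * Lmax\<^sup>2 * 2 \<le> 4 * k\<^sup>2 * Lmax\<^sup>2 * (6 - max 1 (4 * (Lmin / Lmax)\<^sup>2))"
    using xi by (intro mult_left_mono) auto
  then show ?thesis using k_bound by simp
qed

lemma k_small_eigenvalue:
  assumes "v \<in> unit_eigenvectors A"
  shows "8 * k\<^sup>2 * (v \<bullet> (W *v v))\<^sup>2 \<le> 1"
proof -
  have "8 * k\<^sup>2 * (v \<bullet> (W *v v))\<^sup>2 \<le> 8 * k\<^sup>2 * Lmax\<^sup>2"
    using eigenvalue_W_bounds[OF assms] by (intro mult_left_mono power_mono) auto
  then show ?thesis using k_small by linarith
qed

section \<open>Range and zero of the potential, and the range of the warp angle\<close>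

lemma V_bounds:
  assumes "R \<in> SO3"
  shows "0 \<le> V_pot A R" "V_pot A R \<le> 2 * Lmax"
proof -
  obtain a e where ae: "a\<^sup>2 + e \<bullet> e = 1" "R = quat_rot a e" by (rule SO3_obtain_quat_rot[OF assms])
  have V: "V_pot A R = 2 * (e \<bullet> (W *v e))" by (simp add: ae V_pot_quat_rot[OF A_sym])
  have "0 \<le> Lmin * (e \<bullet> e)" using Lmin_pos by simp
  then show "0 \<le> V_pot A R" using W_quad_ge[of e] V by linarith
  have "e \<bullet> e \<le> 1" using ae(1) zero_le_power2[of a] by linarith
  then have "Lmax * (e \<bullet> e) \<le> Lmax * 1" using Lmin_pos Lmin_le_Lmax by (intro mult_left_mono) auto
  then show "V_pot A R \<le> 2 * Lmax" using W_quad_le[of e] V by linarith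
qed

lemma V_one: "V_pot A (mat 1) = 0"
  by (simp add: V_pot_def matrix_mul.zero_right) (simp add: trace_def)

lemma V_eq_0_iff:
  assumes "R \<in> SO3"
  shows "V_pot A R = 0 \<longleftrightarrow> R = mat 1"
proof
  assume 0: "V_pot A R = 0"
  obtain a e where ae: "a\<^sup>2 + e \<bullet> e = 1" "R = quat_rot a e" by (rule SO3_obtain_quat_rot[OF assms])
  have "Lmin * (e \<bullet> e) \<le> 0" using W_quad_ge[of e] 0 by (simp add: ae V_pot_quat_rot[OF A_sym])
  then have "e \<bullet> e \<le> 0" using Lmin_pos by (simp add: mult_le_0_iff)
  then have e: "e = 0" by (metis inner_gt_zero_iff not_le)
  \<comment> \<open>For \<open>e = 0\<close> only \<open>a^2\<close> enters, so \<open>a = 1\<close>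
    and \<open>a = - 1\<close> both give the identity.\<close>
  then have "quat_rot a e = quat_rot 1 0" using ae(1) by (simp only: quat_rot_def) (simp add: vec_eq_iff forall_3)
  then show "R = mat 1" by (simp add: ae)
qed (simp add: V_one)

lemma kV_sq: "R \<in> SO3 \<Longrightarrow> (k * V_pot A R)\<^sup>2 < 1 / 2"
proof -
  assume "R \<in> SO3"
  then have "k\<^sup>2 * (V_pot A R)\<^sup>2 \<le> k\<^sup>2 * (2 * Lmax)\<^sup>2"
    using V_bounds by (intro mult_left_mono power_mono) auto
  then show ?thesis using k_small by (simp add: power_mult_distrib)
qed

lemma kV_abs: "R \<in> SO3 \<Longrightarrow> \<bar>k * V_pot A R\<bar> < 1"
  using kV_sq[of R] by (simp add: abs_square_less_1[symmetric])

lemma sin_half_warp_angle: "R \<in> SO3 \<Longrightarrow> sin (warp_angle A k R / 2) = k * V_pot A R"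
  using kV_abs[of R] by (simp add: warp_angle_def abs_less_iff)

lemma warp_SO3: "R \<in> SO3 \<Longrightarrow> warp A u k R \<in> SO3"
  unfolding warp_def by (intro SO3_mult rot_axis_SO3 u)

text \<open>The constant \<open>6 - max 1 (4\<xi>\<^sup>2)\<close> enters here: in the direction \<open>R [u]\<close> the warp angle changes
  at a rate below \<open>1\<close>, so that \<open>\<Gamma>\<close> is a local diffeomorphism.\<close>

lemma warp_rate_nondegenerate:
  assumes "R \<in> SO3"
  shows "1 + warp_rate A k R (R ** skew u) \<noteq> 0"
proof -
  obtain a e where ae: "a\<^sup>2 + e \<bullet> e = 1" "R = quat_rot a e" by (rule SO3_obtain_quat_rot[OF assms])
  define x m n where "x = e \<bullet> e" and "m = e \<bullet> (W *v e)" and "n = (W *v e) \<bullet> (W *v e)"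
  define g where "g = (W *v e) \<bullet> (a *\<^sub>R u + cross3 e u)"
  have V: "V_pot A R = 2 * m" by (simp add: ae V_pot_quat_rot[OF A_sym] m_def)
  have rate: "warp_rate A k R (R ** skew u) = 4 * k * g / sqrt (1 - (k * V_pot A R)\<^sup>2)"
    by (simp add: warp_rate_def ae(2) trace_quat_rot_skew[OF A_sym] g_def)
  have x: "0 \<le> x" "x \<le> 1" using ae(1) zero_le_power2[of a] unfolding x_def by (simp, linarith)
  \<comment> \<open>\<open>?h\<close> represents \<open>g\<close> as a linear form in
    \<open>u\<close>. Its two summands are orthogonal, and Lagrange's identity with
    \<open>a^2 + x = 1\<close> gives it the squared norm \<open>n - m^2\<close>.\<close>
  let ?h = "a *\<^sub>R (W *v e) + cross3 (W *v e) e"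
  have "g = ?h \<bullet> u"
    by (simp add: g_def inner_add_left inner_add_right) (simp add: cross3_def inner_vec_def sum_3 algebra_simps)
  then have "g\<^sup>2 \<le> (?h \<bullet> ?h) * (u \<bullet> u)" using Cauchy_Schwarz_ineq by simp
  also have "\<dots> = a\<^sup>2 * n + (n * x - m\<^sup>2)"
    using u by (simp add: inner_add_left inner_add_right inner_cross_cross dot_cross_self norm_eq_1
        x_def m_def n_def inner_commute power2_eq_square)
  also have "\<dots> = n - m\<^sup>2" using ae(1) by (simp add: x_def) algebra
  finally have g: "g\<^sup>2 \<le> n - m\<^sup>2" .
  have LL: "Lmax \<noteq> 0" using Lmin_pos Lmin_le_Lmax by auto
  \<comment> \<open>The rate is below 1 in modulus iff \<open>16 k^2 g^2 < 1 - 4 k^2 m^2\<close>; by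
    the bound on \<open>g\<close> it is enough that \<open>4 k^2 (4 n - 3 m^2) < 1\<close>.\<close>
  have "n \<le> Lmax\<^sup>2 * x" using W_sq_le by (simp add: n_def x_def)
  moreover have "(Lmin * x)\<^sup>2 \<le> m\<^sup>2"
    using W_quad_ge[of e] Lmin_pos x(1) by (intro power_mono) (auto simp: m_def x_def)
  ultimately have "4 * n - 3 * m\<^sup>2 \<le> 4 * (Lmax\<^sup>2 * x) - 3 * (Lmin * x)\<^sup>2" by linarith
  also have "\<dots> = Lmax\<^sup>2 * (4 * x - 3 * (Lmin / Lmax)\<^sup>2 * x\<^sup>2)"
    using LL by (simp add: field_simps power2_eq_square)
  also have "\<dots> \<le> Lmax\<^sup>2 * (6 - max 1 (4 * (Lmin / Lmax)\<^sup>2))"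
    by (intro mult_left_mono warp_bound_ineq x xi) auto
  finally have "4 * k\<^sup>2 * (4 * n - 3 * m\<^sup>2) \<le> 4 * k\<^sup>2 * (Lmax\<^sup>2 * (6 - max 1 (4 * (Lmin / Lmax)\<^sup>2)))"
    by (rule mult_left_mono) simp
  then have "16 * k\<^sup>2 * n - 12 * k\<^sup>2 * m\<^sup>2 < 1" using k_bound by (simp add: algebra_simps)
  moreover have "16 * k\<^sup>2 * g\<^sup>2 \<le> 16 * k\<^sup>2 * (n - m\<^sup>2)" using g by (intro mult_left_mono) auto
  ultimately have "(4 * k * g)\<^sup>2 < 1 - (k * V_pot A R)\<^sup>2"
    by (simp add: V power_mult_distrib algebra_simps)
  then have lt: "\<bar>4 * k * g\<bar> < sqrt (1 - (k * V_pot A R)\<^sup>2)" by (simp add: real_less_rsqrt)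
  then have "0 < sqrt (1 - (k * V_pot A R)\<^sup>2)" by linarith
  with lt have "\<bar>warp_rate A k R (R ** skew u)\<bar> < 1"
    unfolding rate abs_divide by (simp only: abs_of_pos divide_less_eq_1_pos)
  then show ?thesis by linarith
qed

text \<open>For a quaternion \<open>(a, e)\<close> criticality means
  \<open>a W e + W e \<times> e = 0\<close>. Pairing with \<open>W e\<close> gives
  \<open>a = 0\<close> or \<open>e = 0\<close>; if \<open>a = 0\<close>, then \<open>W e\<close> is
  parallel to \<open>e\<close>.\<close>

lemma critical_V_iff:
  assumes "S \<in> SO3"
  shows "(\<forall>z. trace (A ** (S ** skew z)) = 0) \<longleftrightarrow>
    S = mat 1 \<or> (\<exists>v\<in>unit_eigenvectors A. S = quat_rot 0 v)"
proof
  assume 0: "\<forall>z. trace (A ** (S ** skew z)) = 0"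
  obtain a e where ae: "a\<^sup>2 + e \<bullet> e = 1" "S = quat_rot a e" by (rule SO3_obtain_quat_rot[OF assms])
  let ?h = "a *\<^sub>R (W *v e) + cross3 (W *v e) e"
  have "?h \<bullet> z = 0" for z
  proof -
    have "?h \<bullet> z = (W *v e) \<bullet> (a *\<^sub>R z + cross3 e z)"
      by (simp add: inner_add_left inner_add_right) (simp add: cross3_def inner_vec_def sum_3 algebra_simps)
    then show ?thesis using 0 by (simp add: ae(2) trace_quat_rot_skew[OF A_sym])
  qed
  then have h: "?h = 0" by (metis inner_eq_zero_iff)
  have "a * ((W *v e) \<bullet> (W *v e)) = ?h \<bullet> (W *v e)" by (simp add: inner_add_left dot_cross_self)
  then have "a = 0 \<or> e = 0" using h W_nonsing by simp
  then show "S = mat 1 \<or> (\<exists>v\<in>unit_eigenvectors A. S = quat_rot 0 v)"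
  proof
    assume "e = 0"
    then have "V_pot A S = 0" using ae by (simp add: V_pot_quat_rot[OF A_sym])
    then show ?thesis using V_eq_0_iff[OF assms] by simp
  next
    assume a: "a = 0"
    then have ee: "e \<bullet> e = 1" and "cross3 (W *v e) e = 0" using ae h by auto
    then have "(W *v e) \<bullet> (W *v e) - (e \<bullet> (W *v e))\<^sup>2 = 0"
      using inner_cross_cross[of "W *v e" e "W *v e" e] by (simp add: inner_commute power2_eq_square)
    \<comment> \<open>The component of \<open>W e\<close> orthogonal to the unit vector
      \<open>e\<close>; its squared norm is the expression just shown to vanish.\<close>
    moreover define d where "d = W *v e - (e \<bullet> (W *v e)) *\<^sub>R e"
    ultimately have "d \<bullet> d = 0"
      using ee by (simp add: inner_diff_left inner_diff_right inner_commute[of "W *v e" e] power2_eq_square)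
    then have "W *v e = (e \<bullet> (W *v e)) *\<^sub>R e" by (simp add: d_def)
    then have "e \<in> unit_eigenvectors A" by (rule unit_eigenvectorI[rotated]) (simp add: norm_eq_1 ee)
    then show ?thesis using ae a by auto
  qed
next
  assume "S = mat 1 \<or> (\<exists>v\<in>unit_eigenvectors A. S = quat_rot 0 v)"
  then obtain a e c where S: "S = quat_rot a e" "W *v e = c *\<^sub>R e" "a = 0 \<or> e = 0"
  proof
    assume "S = mat 1"
    then show thesis using that[of 1 0 0] by simp
  next
    assume "\<exists>v\<in>unit_eigenvectors A. S = quat_rot 0 v"
    then show thesis using that unit_eigenvector_W by blast
  qed
  have "a *\<^sub>R (c *\<^sub>R e) = 0" using S(3) by auto
  moreover have "(c *\<^sub>R e) \<bullet> (a *\<^sub>R z) = (a *\<^sub>R (c *\<^sub>R e)) \<bullet> z" for z by simp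
  ultimately show "\<forall>z. trace (A ** (S ** skew z)) = 0"
    by (simp add: S(1,2) trace_quat_rot_skew[OF A_sym] inner_add_right dot_cross_self)
qed

text \<open>By \<open>warp_deriv_skew\<close> it suffices that the transported directions exhaust
  all of space, which follows from \<open>1 + \<rho> u \<noteq> 0\<close>.\<close>

lemma critical_warp_iff:
  assumes R: "R \<in> SO3"
  shows "has_gradient_SO3 (\<lambda>R. V_pot A (warp A u k R)) 0 R \<longleftrightarrow>
    warp A u k R = mat 1 \<or> (\<exists>v\<in>unit_eigenvectors A. warp A u k R = quat_rot 0 v)"
proof -
  define P where "P = rot_axis (warp_angle A k R) u"
  define \<rho> where "\<rho> w = warp_rate A k R (R ** skew w)" for w
  have P: "P ** transpose P = mat 1" "transpose P ** P = mat 1" "P *v u = u"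
    using rot_axis_SO3[OF u] rot_axis_eigen[OF u]
    by (auto simp: P_def SO3_def rotation_matrix_def orthogonal_matrix_def)
  have \<rho>: "\<rho> (x + y) = \<rho> x + \<rho> y" "\<rho> (c *\<^sub>R x) = c * \<rho> x" for x y c
    by (simp_all add: \<rho>_def skew_add skew_scaleR matrix_mul.add_right matrix_mul.scaleR_right warp_rate_linear)
  have 1: "1 + \<rho> u \<noteq> 0" using warp_rate_nondegenerate[OF R] by (simp add: \<rho>_def)
  have onto: "\<exists>w. transpose P *v w + \<rho> w *\<^sub>R u = z" for z
  proof
    \<comment> \<open>As \<open>P\<close> fixes \<open>u\<close>, the equation reads
      \<open>w = P z - \<rho>(w) u\<close>; applying \<open>\<rho>\<close> to it determines
      \<open>\<rho>(w)\<close> as \<open>?t\<close>.\<close>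
    let ?t = "\<rho> (P *v z) / (1 + \<rho> u)" and ?w = "P *v z + (- \<rho> (P *v z) / (1 + \<rho> u)) *\<^sub>R u"
    have "\<rho> ?w = \<rho> (P *v z) - ?t * \<rho> u" unfolding \<rho> by simp
    also have "\<dots> = ?t" using 1 by (simp add: field_simps)
    finally have w: "\<rho> ?w = ?t" .
    have "transpose P *v u = u" using P by (metis matrix_vector_mul_assoc matrix_vector_mul_lid)
    moreover have "transpose P *v (P *v z) = z" using P(2) by (metis matrix_vector_mul_assoc matrix_vector_mul_lid)
    ultimately show "transpose P *v ?w + \<rho> ?w *\<^sub>R u = z"
      unfolding w by (simp add: matrix_vector_right_distrib matrix_vector_mult_diff_distrib matrix_vector_mult_scaleR del: transpose_matrix_vector)
  qed
  have "has_gradient_SO3 (\<lambda>R. V_pot A (warp A u k R)) 0 R \<longleftrightarrow>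
      (\<forall>w. warp_deriv A u k R (R ** skew w) = 0)"
    by (rule has_zero_gradient_SO3_iff[OF R has_derivative_at_withinI[OF V_pot_warp_has_derivative[OF u kV_abs[OF R]]]])
  also have "\<dots> \<longleftrightarrow> (\<forall>w. trace (A ** (warp A u k R ** skew (transpose P *v w + \<rho> w *\<^sub>R u))) = 0)"
    by (simp add: warp_deriv_skew[OF u] P_def \<rho>_def del: transpose_matrix_vector)
  also have "\<dots> \<longleftrightarrow> (\<forall>z. trace (A ** (warp A u k R ** skew z)) = 0)"
    using onto by metis
  finally show ?thesis using critical_V_iff[OF warp_SO3[OF R]] by simp
qed

text \<open>If the warp is the identity, then \<open>R\<close> is a rotation about \<open>u\<close>
  and \<open>V = V_pot A R\<close> satisfies \<open>V = 2 k^2 V^2 (u \<bullet> W u)\<close>. A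
  nonzero \<open>V\<close> would need \<open>2 k^2 V (u \<bullet> W u) = 1\<close>, too large for
  the bound on \<open>k\<close>.\<close>

lemma warp_eq_one_iff:
  assumes R: "R \<in> SO3"
  shows "warp A u k R = mat 1 \<longleftrightarrow> R = mat 1"
proof
  assume "R = mat 1"
  then show "warp A u k R = mat 1" by (simp add: warp_def warp_angle_def V_one rot_axis_0[OF u])
next
  assume 1: "warp A u k R = mat 1"
  define t where "t = warp_angle A k R"
  define V where "V = V_pot A R"
  have "R = R ** (rot_axis t u ** rot_axis (- t) u)" by (simp add: rot_axis_add[OF u] rot_axis_0[OF u])
  also have "\<dots> = warp A u k R ** rot_axis (- t) u" by (simp add: warp_def t_def matrix_mul_assoc)
  also have "\<dots> = quat_rot (cos (t / 2)) (- sin (t / 2) *\<^sub>R u)" using 1 by (simp add: rot_axis_quat_rot[OF u])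
  finally have R_eq: "R = quat_rot (cos (t / 2)) (- sin (t / 2) *\<^sub>R u)" .
  have "V_pot A (quat_rot c (s *\<^sub>R u)) = 2 * s\<^sup>2 * (u \<bullet> (W *v u))" if "c\<^sup>2 + s\<^sup>2 = 1" for c s
    using that u V_pot_quat_rot[OF A_sym, of c "s *\<^sub>R u"]
    by (simp add: matrix_vector_mult_scaleR norm_eq_1 power2_eq_square)
  from this[of "cos (t / 2)" "- sin (t / 2)"] have "V = 2 * (sin (t / 2))\<^sup>2 * (u \<bullet> (W *v u))"
    unfolding V_def R_eq by simp
  also have "\<dots> = V * (2 * k\<^sup>2 * V * (u \<bullet> (W *v u)))"
    by (simp add: t_def V_def sin_half_warp_angle[OF R] power2_eq_square)
  finally have "V = 0 \<or> 2 * k\<^sup>2 * V * (u \<bullet> (W *v u)) = 1" by simp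
  moreover have "V * (u \<bullet> (W *v u)) \<le> (2 * Lmax) * Lmax"
    using V_bounds[OF R] W_quad_le[of u] W_quad_ge[of u] u Lmin_pos Lmin_le_Lmax
    by (intro mult_mono) (auto simp: V_def norm_eq_1)
  then have "2 * k\<^sup>2 * (V * (u \<bullet> (W *v u))) \<le> 2 * k\<^sup>2 * ((2 * Lmax) * Lmax)" by (rule mult_left_mono) simp
  then have "2 * k\<^sup>2 * V * (u \<bullet> (W *v u)) < 1"
    using k_small zero_le_power2[of "k * Lmax"] by (simp add: power2_eq_square algebra_simps)
  ultimately show "R = mat 1" using V_eq_0_iff[OF R] by (simp add: V_def)
qed

text \<open>The product quaternion has vector part
  \<open>cos (t/2) v - sin (t/2) (u \<times> v)\<close>; the mixed terms of the quadratic form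
  vanish, since \<open>W v\<close> is parallel to \<open>v\<close> and \<open>v\<close> is
  orthogonal to \<open>u \<times> v\<close>.\<close>

lemma V_half_turn:
  assumes v: "v \<in> unit_eigenvectors A"
  shows "V_pot A (quat_rot 0 v ** rot_axis t u) = 2 * (v \<bullet> (W *v v) - (sin (t / 2))\<^sup>2 * Delta_quad u v)"
proof -
  define c s where "c = cos (t / 2)" and "s = sin (t / 2)"
  define x where "x = cross3 u v"
  have vv: "v \<bullet> v = 1" using v by (simp add: unit_eigenvectors_def norm_eq_1)
  have cs: "c\<^sup>2 = 1 - s\<^sup>2" by (simp add: c_def s_def cos_squared_eq)
  have eq: "quat_rot 0 v ** rot_axis t u = quat_rot (- s * (v \<bullet> u)) (c *\<^sub>R v - s *\<^sub>R x)"
    by (simp add: rot_axis_quat_rot[OF u] quat_rot_mult c_def s_def x_def cross_mult_right cross_skew[of v u])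
  have xx: "x \<bullet> x = 1 - (v \<bullet> u)\<^sup>2" "v \<bullet> x = 0"
    using u vv by (simp_all add: x_def inner_cross_cross dot_cross_self norm_eq_1 inner_commute power2_eq_square)
  have unit: "(- s * (v \<bullet> u))\<^sup>2 + (c *\<^sub>R v - s *\<^sub>R x) \<bullet> (c *\<^sub>R v - s *\<^sub>R x) = 1"
    using cs by (simp add: inner_diff_left inner_diff_right vv xx inner_commute[of x v] power_mult_distrib
        power2_eq_square[symmetric] right_diff_distrib flip: mult.assoc)
  have vWx: "v \<bullet> (W *v x) = 0" "x \<bullet> (W *v v) = 0"
  proof -
    show "x \<bullet> (W *v v) = 0"
      by (subst unit_eigenvector_W[OF v]) (simp add: xx inner_commute[of x v])
    then show "v \<bullet> (W *v x) = 0" by (simp only: W_sym[of v x] inner_commute)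
  qed
  show ?thesis
    unfolding eq V_pot_quat_rot[OF A_sym unit]
    by (simp add: matrix_vector_mult_diff_distrib matrix_vector_mult_scaleR inner_diff_left inner_diff_right vWx
        Delta_quad_def cs flip: s_def x_def power2_eq_square mult.assoc) (simp add: algebra_simps)
qed

lemma half_turn_neq_one:
  assumes v: "v \<in> unit_eigenvectors A"
  shows "quat_rot 0 v \<noteq> mat 1"
  using V_half_turn[OF v, of 0] eigenvalue_W_bounds(1)[OF v] V_one by (auto simp: rot_axis_0[OF u])

text \<open>Undoing the rotation expresses \<open>R\<close> through its own warp angle, so
  \<open>V_half_turn\<close> becomes a quadratic equation for \<open>V_pot A R\<close>.\<close>

lemma half_turn_preimage:
  assumes v: "v \<in> unit_eigenvectors A" and D: "0 < Delta_quad u v" and R: "R \<in> SO3"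
    and warp: "warp A u k R = quat_rot 0 v"
  shows "R = quat_rot 0 v ** rot_axis (- warp_angle A k R) u"
    and "V_pot A R = V_bar k (v \<bullet> (W *v v)) (Delta_quad u v)"
proof -
  define t where "t = warp_angle A k R"
  have "R = R ** (rot_axis t u ** rot_axis (- t) u)" by (simp add: rot_axis_add[OF u] rot_axis_0[OF u])
  also have "\<dots> = quat_rot 0 v ** rot_axis (- t) u" by (simp add: warp[symmetric] warp_def t_def matrix_mul_assoc)
  finally show R': "R = quat_rot 0 v ** rot_axis (- warp_angle A k R) u" by (simp add: t_def)
  have "V_pot A R = 2 * (v \<bullet> (W *v v) - (k * V_pot A R)\<^sup>2 * Delta_quad u v)"
    using arg_cong[OF R', of "V_pot A"] sin_half_warp_angle[OF R] by (simp add: V_half_turn[OF v])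
  then show "V_pot A R = V_bar k (v \<bullet> (W *v v)) (Delta_quad u v)"
    by (intro V_bar_unique k0 D eigenvalue_W_bounds v V_bounds R) (simp add: power_mult_distrib algebra_simps)
qed

text \<open>Build \<open>R\<close> with the angle that \<open>V_bar\<close> prescribes; the
  quadratic equation then confirms that \<open>V_pot A R\<close> is \<open>V_bar\<close>, so the
  prescribed angle is the actual warp angle.\<close>

lemma half_turn_attained:
  assumes v: "v \<in> unit_eigenvectors A" and D: "0 < Delta_quad u v"
  shows "\<exists>R\<in>SO3. warp A u k R = quat_rot 0 v"
proof
  let ?V = "V_bar k (v \<bullet> (W *v v)) (Delta_quad u v)"
  define t where "t = 2 * arcsin (k * ?V)"
  define R where "R = quat_rot 0 v ** rot_axis (- t) u"
  note V = V_bar_root[OF k0 eigenvalue_W_bounds(1)[OF v] D]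
  have "(k * ?V)\<^sup>2 \<le> 1 / 2"
    using V_bar_sq_le[OF k0 eigenvalue_W_bounds(1)[OF v] D k_small_eigenvalue[OF v]] by (simp add: power_mult_distrib)
  then have "\<bar>k * ?V\<bar> < 1" by (simp add: abs_square_less_1[symmetric])
  then have s: "sin (t / 2) = k * ?V" by (simp add: t_def abs_less_iff)
  have "V_pot A R = 2 * (v \<bullet> (W *v v) - (k * ?V)\<^sup>2 * Delta_quad u v)"
    by (simp add: R_def V_half_turn[OF v] s)
  also have "\<dots> = ?V" using V(2) by (simp add: power_mult_distrib algebra_simps)
  finally have "warp_angle A k R = t" by (simp add: warp_angle_def t_def)
  then show "warp A u k R = quat_rot 0 v"
    by (simp add: warp_def R_def matrix_mul_assoc[symmetric] rot_axis_add[OF u] rot_axis_0[OF u])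
  have "quat_rot 0 v \<in> SO3" by (rule quat_rot_SO3) (use v in \<open>simp add: unit_eigenvectors_def norm_eq_1\<close>)
  then show "R \<in> SO3" unfolding R_def by (intro SO3_mult rot_axis_SO3 u)
qed

text \<open>The opposite gain has the opposite angle \<open>- t\<close>, while \<open>R\<close>
  itself is already the half turn rotated by \<open>- t\<close>; the angles add to
  \<open>- 2 t\<close>.\<close>

lemma half_turn_gap:
  assumes v: "v \<in> unit_eigenvectors A" and D: "0 < Delta_quad u v" and R: "R \<in> SO3"
    and warp: "warp A u k R = quat_rot 0 v"
  shows "V_pot A (warp A u k R) - min (V_pot A (warp A u k R)) (V_pot A (warp A u (- k) R)) =
    gap_sigma k (v \<bullet> (W *v v)) (Delta_quad u v)"
proof -
  define t where "t = warp_angle A k R"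
  let ?V = "V_bar k (v \<bullet> (W *v v)) (Delta_quad u v)"
  note R' = half_turn_preimage[OF v D R warp]
  have "\<bar>k * V_pot A R\<bar> < 1" by (rule kV_abs[OF R])
  then have "warp_angle A (- k) R = - t" by (simp add: t_def warp_angle_def arcsin_minus abs_less_iff)
  then have "warp A u (- k) R = R ** rot_axis (- t) u" by (simp add: warp_def)
  also have "\<dots> = quat_rot 0 v ** rot_axis (- (2 * t)) u"
    by (subst R'(1)) (simp add: matrix_mul_assoc[symmetric] rot_axis_add[OF u] t_def)
  finally have other: "V_pot A (warp A u (- k) R) = 2 * (v \<bullet> (W *v v) - (sin t)\<^sup>2 * Delta_quad u v)"
    by (simp add: V_half_turn[OF v])
  have same: "V_pot A (warp A u k R) = 2 * (v \<bullet> (W *v v))"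
    using V_half_turn[OF v, of 0] by (simp add: warp rot_axis_0[OF u])
  have s: "sin (t / 2) = k * ?V" using sin_half_warp_angle[OF R] by (simp add: t_def R'(2))
  have "(sin t)\<^sup>2 = (2 * sin (t / 2) * cos (t / 2))\<^sup>2" using sin_double[of "t / 2"] by simp
  also have "\<dots> = 4 * (sin (t / 2))\<^sup>2 * (1 - (sin (t / 2))\<^sup>2)" by (simp add: power_mult_distrib cos_squared_eq)
  finally have "2 * ((sin t)\<^sup>2 * Delta_quad u v) = gap_sigma k (v \<bullet> (W *v v)) (Delta_quad u v)"
    by (simp add: s gap_sigma_def power_mult_distrib)
  moreover have "0 \<le> (sin t)\<^sup>2 * Delta_quad u v" using D by simp
  ultimately show ?thesis by (simp add: same other min_def)
qed

lemma C1_warp: "C1_SO3 (\<lambda>R. V_pot A (warp A u k R))"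
proof (rule C1_SO3I)
  show "((\<lambda>R. V_pot A (warp A u k R)) has_derivative warp_deriv A u k R) (at R within SO3)" if "R \<in> SO3" for R
    by (rule has_derivative_at_withinI[OF V_pot_warp_has_derivative[OF u kV_abs[OF that]]])
  have tr: "continuous_on SO3 (\<lambda>R. trace (h R))" if "continuous_on SO3 h" for h :: "real^3^3 \<Rightarrow> real^3^3"
    by (rule bounded_linear.continuous_on[OF bounded_linear_trace that])
  note intros = continuous_intros tr bounded_bilinear.continuous_on[OF bounded_bilinear_matrix_mul]
  have V: "continuous_on SO3 (V_pot A)" unfolding V_pot_def by (intro intros)
  have t: "continuous_on SO3 (warp_angle A k)"
    unfolding warp_angle_def using kV_abs by (intro intros V) (auto simp: abs_less_iff intro: less_imp_le)
  have P: "continuous_on SO3 (\<lambda>R. rot_axis (warp_angle A k R) u)"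
    unfolding rot_axis_rodrigues[OF u] by (intro intros t)
  have "continuous_on SO3 (\<lambda>R. warp_rate A k R (R ** skew w))" for w
    unfolding warp_rate_def using kV_sq by (intro intros V) force
  then show "continuous_on SO3 (\<lambda>R. warp_deriv A u k R (R ** skew w))" for w
    unfolding warp_deriv_def warp_def by (intro intros P)
qed

end

section \<open>Attained minima and the synergistic gap\<close>

lemma continuous_attains_minimum:
  fixes f :: "'a::topological_space \<Rightarrow> real"
  assumes "compact S" "S \<noteq> {}" "continuous_on S f"
  obtains m where "is_minimum m (f ` S)"
  using continuous_attains_inf[OF assms] unfolding is_minimum_def by blast

lemma gap_sigma_minus: "gap_sigma (- k) lam D = gap_sigma k lam D"
  by (simp add: gap_sigma_def V_bar_def)

theorem theorem2:
  fixes A :: "real^3^3" and u :: "real^3" and k \<xi> :: real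
    and Q :: "nat set" and \<kappa> :: "nat \<Rightarrow> real"
    and l :: "3 \<Rightarrow> real" and b :: "3 \<Rightarrow> real^3"
    and U :: "(real^3^3) \<times> nat \<Rightarrow> real"
  assumes u: "u \<in> sphere 0 1"
    and A: "transpose A = A"
    and W: "sym_pos_def (W_mat A)"
    and Q: "Q = {1, 2}"
    and \<kappa>: "\<kappa> 1 = k" "\<kappa> 2 = - k" "k \<noteq> 0"
    and \<xi>: "\<xi> = lam_min (W_mat A) / lam_max (W_mat A)"
    and k: "\<bar>k\<bar> < 1 / (2 * lam_max (W_mat A) * sqrt (6 - max 1 (4 * \<xi>\<^sup>2)))"
    and frame: "eigenframe A l b"
    and Delta_pos: "\<And>v. v \<in> unit_eigenvectors A \<Longrightarrow> 0 < Delta A l b v u"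
    and U: "U = (\<lambda>x. V_pot A (Gamma_warp A u \<kappa> x))"
  shows "centrally_synergistic Q U \<and>
    (\<exists>gap lam0 Delta0.
       has_synergistic_gap Q U gap \<and>
       is_minimum gap
         ((\<lambda>v. gap_sigma k (eigenvalue_of (W_mat A) v) (Delta A l b v u)) ` unit_eigenvectors A) \<and>
       is_minimum lam0 (eigenvalue_of (W_mat A) ` unit_eigenvectors A) \<and>
       is_minimum Delta0 ((\<lambda>v. Delta A l b v u) ` unit_eigenvectors A) \<and>
       gap_sigma k lam0 Delta0 \<le> gap)"
proof -
  interpret eigenframe_pd A l b by unfold_locales (fact frame, fact W)
  have nu: "norm u = 1" using u by simp
  define m where "m = 6 - max 1 (4 * \<xi>\<^sup>2)"
  have "\<xi>\<^sup>2 \<le> 1" using Lmin_pos Lmin_le_Lmax unfolding \<xi> by (intro power_le_one) auto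
  then have m: "0 < m" by (simp add: m_def)
  have L: "0 < Lmax" using Lmin_pos Lmin_le_Lmax by linarith
  \<comment> \<open>Clearing the positive denominator and squaring turns the hypothesis on
    \<open>k\<close> into the bound of the locale.\<close>
  have "\<bar>k\<bar> * (2 * Lmax * sqrt m) < 1"
    using k m L by (simp add: m_def[symmetric] pos_less_divide_eq)
  moreover have "0 \<le> \<bar>k\<bar> * (2 * Lmax * sqrt m)" using L m by simp
  ultimately have "(\<bar>k\<bar> * (2 * Lmax * sqrt m))\<^sup>2 < 1" by (simp only: power_less_one_iff abs_square_less_1)
  then have "4 * k\<^sup>2 * Lmax\<^sup>2 * m < 1" using m by (simp add: power_mult_distrib mult_ac)
  then have wq: "warped_potential A l b u (\<kappa> q)" if "q \<in> Q" for q
    using that \<kappa> nu A by unfold_locales (auto simp: Q m_def \<xi>)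
  have sigma_q: "gap_sigma (\<kappa> q) lam D = gap_sigma k lam D" if "q \<in> Q" for q lam D
    using that \<kappa>(1,2) by (auto simp: Q gap_sigma_minus)
  have U_eq: "U (R, q) = V_pot A (warp A u (\<kappa> q) R)" for R q
    by (simp add: U Gamma_warp_def warp_def)
  let ?E = "unit_eigenvectors A"
  define \<sigma> where "\<sigma> v = gap_sigma k (v \<bullet> (W *v v)) (Delta_quad u v)" for v
  have Delta_quad_pos: "0 < Delta_quad u v" if "v \<in> ?E" for v
    using Delta_pos[OF that] Delta_eq[OF that nu] by simp

  have pot: "U \<in> potential_functions Q"
  proof -
    have C1: "C1_SO3 (\<lambda>R. U (R, q))" if "q \<in> Q" for q
      unfolding U_eq by (rule warped_potential.C1_warp[OF wq[OF that]])
    have nonneg: "0 \<le> U (R, q)" and zero: "U (R, q) = 0 \<longleftrightarrow> R = mat 1" if "R \<in> SO3" "q \<in> Q" for R q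
    proof -
      interpret q: warped_potential A l b u "\<kappa> q" by (rule wq[OF that(2)])
      show "0 \<le> U (R, q)" "U (R, q) = 0 \<longleftrightarrow> R = mat 1"
        unfolding U_eq using q.V_bounds q.V_eq_0_iff q.warp_SO3 q.warp_eq_one_iff that(1) by auto
    qed
    have "mat 1 \<in> SO3" by (metis quat_rot_SO3 quat_rot_one inner_zero_left add.right_neutral one_power2)
    then show ?thesis
      unfolding potential_functions_def attractor_def using C1 nonneg zero by (force simp: less_le)
  qed

  have image: "(\<lambda>(R, q). U (R, q) - Min ((\<lambda>p. U (R, p)) ` Q)) ` (critical_set Q U - attractor Q) = \<sigma> ` ?E"
    (is "?G ` ?C = _")
  proof
    have gap_at: "?G (R, q) = \<sigma> v"
      if "R \<in> SO3" "q \<in> Q" "v \<in> ?E" "warp A u (\<kappa> q) R = quat_rot 0 v" for R q v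
    proof -
      \<comment> \<open>Of the two elements of \<open>Q\<close>, the one other than \<open>q\<close>
        has gain \<open>- \<kappa> q\<close>.\<close>
      have "Min ((\<lambda>p. U (R, p)) ` Q) = min (V_pot A (warp A u (\<kappa> q) R)) (V_pot A (warp A u (- \<kappa> q) R))"
        using that(2) \<kappa>(1,2) by (auto simp: Q U_eq min.commute)
      then show ?thesis
        using warped_potential.half_turn_gap[OF wq[OF that(2)] that(3) Delta_quad_pos[OF that(3)] that(1,4)]
        by (simp add: U_eq \<sigma>_def sigma_q[OF that(2)])
    qed
    show "?G ` ?C \<subseteq> \<sigma> ` ?E"
    proof
      fix y assume "y \<in> ?G ` ?C"
      then obtain R q where Rq: "R \<in> SO3" "q \<in> Q" "has_gradient_SO3 (\<lambda>R. U (R, q)) 0 R" "R \<noteq> mat 1"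
        and y: "y = ?G (R, q)"
        by (auto simp: critical_set_def attractor_def)
      interpret q: warped_potential A l b u "\<kappa> q" by (rule wq[OF Rq(2)])
      obtain v where "v \<in> ?E" "warp A u (\<kappa> q) R = quat_rot 0 v"
        using Rq q.critical_warp_iff q.warp_eq_one_iff unfolding U_eq by blast
      then show "y \<in> \<sigma> ` ?E" using gap_at[OF Rq(1,2)] y by blast
    qed
    show "\<sigma> ` ?E \<subseteq> ?G ` ?C"
    proof
      fix y assume "y \<in> \<sigma> ` ?E"
      then obtain v where v: "v \<in> ?E" "y = \<sigma> v" by blast
      \<comment> \<open>One index suffices to attain every value, since \<open>gap_sigma\<close> is
        even in the gain.\<close>
      have 1: "1 \<in> Q" by (simp add: Q)
      interpret q: warped_potential A l b u "\<kappa> 1" by (rule wq[OF 1])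
      obtain R where R: "R \<in> SO3" "warp A u (\<kappa> 1) R = quat_rot 0 v"
        using q.half_turn_attained[OF v(1) Delta_quad_pos[OF v(1)]] by blast
      have "R \<noteq> mat 1" using q.half_turn_neq_one[OF v(1)] q.warp_eq_one_iff[OF R(1)] R(2) by auto
      then have "(R, 1) \<in> ?C"
        using 1 R v(1) q.critical_warp_iff[OF R(1)] by (auto simp: critical_set_def attractor_def U_eq)
      moreover have "y = ?G (R, 1)" using gap_at[OF R(1) 1 v(1) R(2)] v(2) by simp
      ultimately show "y \<in> ?G ` ?C" by blast
    qed
  qed

  have E: "?E \<noteq> {}" using b_unit_eigenvector by blast
  have cW: "continuous_on ?E (\<lambda>v. v \<bullet> (W *v v))"
    by (intro continuous_intros matrix_vector_mult_linear_continuous_on)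
  have cD: "continuous_on ?E (\<lambda>v. Delta_quad u v)"
    unfolding Delta_quad_def
    by (intro continuous_intros continuous_on_cross
        continuous_on_compose2[OF matrix_vector_mult_linear_continuous_on[of UNIV]]) auto
  \<comment> \<open>Keeps the denominator in \<open>V_bar\<close> away from zero, for continuity of
    \<open>\<sigma>\<close>.\<close>
  have "0 < 1 + 16 * (v \<bullet> (W *v v)) * k\<^sup>2 * Delta_quad u v" "4 * k\<^sup>2 * Delta_quad u v \<noteq> 0" if "v \<in> ?E" for v
    using \<kappa>(3) eigenvalue_W_bounds(1)[OF that] Delta_quad_pos[OF that] by (auto intro!: add_pos_pos)
  then have cs: "continuous_on ?E \<sigma>"
    unfolding \<sigma>_def gap_sigma_def V_bar_def by (intro continuous_intros cW cD) auto
  obtain gap where gap: "is_minimum gap (\<sigma> ` ?E)"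
    by (rule continuous_attains_minimum[OF compact_unit_eigenvectors E cs])
  obtain lam0 where lam0: "is_minimum lam0 ((\<lambda>v. v \<bullet> (W *v v)) ` ?E)"
    by (rule continuous_attains_minimum[OF compact_unit_eigenvectors E cW])
  obtain Delta0 where Delta0: "is_minimum Delta0 ((\<lambda>v. Delta_quad u v) ` ?E)"
    by (rule continuous_attains_minimum[OF compact_unit_eigenvectors E cD])
  interpret wp: warped_potential A l b u k using wq[of 1] \<kappa>(1) by (simp add: Q)
  obtain v where v: "v \<in> ?E" "gap = \<sigma> v" using gap by (auto simp: is_minimum_def)
  note small = wp.k_small_eigenvalue[OF v(1)] and lam_pos = eigenvalue_W_bounds(1)[OF v(1)]
  have "0 < lam0" "lam0 \<le> v \<bullet> (W *v v)" "0 < Delta0" "Delta0 \<le> Delta_quad u v"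
    using lam0 Delta0 v(1) eigenvalue_W_bounds(1) Delta_quad_pos by (auto simp: is_minimum_def)
  \<comment> \<open>At a minimiser \<open>v\<close> of \<open>\<sigma>\<close>, first
    \<open>lam0\<close> is raised to the eigenvalue of \<open>v\<close>, then \<open>Delta0\<close>
    to its \<open>Delta_quad\<close>. The two minima need not be attained at the same
    vector.\<close>
  then have le: "gap_sigma k lam0 Delta0 \<le> gap"
    using gap_sigma_mono_lam[OF \<kappa>(3) _ _ _ small, of lam0 Delta0]
      gap_sigma_mono_D[OF \<kappa>(3) lam_pos _ _ small, of Delta0 "Delta_quad u v"] v(2)
    by (simp add: \<sigma>_def)
  have "0 < gap"
    using gap_sigma_pos[OF \<kappa>(3) lam_pos Delta_quad_pos[OF v(1)] small] v(2) by (simp add: \<sigma>_def)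
  moreover have syn: "has_synergistic_gap Q U gap"
    using gap unfolding has_synergistic_gap_def image .
  ultimately have "centrally_synergistic Q U"
    unfolding centrally_synergistic_def using pot by (intro conjI exI[of _ gap] exI[of _ "gap / 2"]) auto
  moreover have "(\<lambda>v. gap_sigma k (eigenvalue_of W v) (Delta A l b v u)) ` ?E = \<sigma> ` ?E"
    "eigenvalue_of W ` ?E = (\<lambda>v. v \<bullet> (W *v v)) ` ?E" "(\<lambda>v. Delta A l b v u) ` ?E = (\<lambda>v. Delta_quad u v) ` ?E"
    by (auto intro!: image_cong simp: \<sigma>_def eigenvalue_of_W Delta_eq nu)
  ultimately show ?thesis using gap lam0 Delta0 syn le by metis
qed

end
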